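(* Let $F$ be Thompson's group $F$ and let $\pi_{ab}\colon F\to\mathbb{Z}^2$ be its standard abelianization map. Let $(a,b),(c,d)\in\mathbb{Z}^2$ be such that $\{a,c\}\neq\{0\}$ and $\{b,d\}\neq\{0\}$ (i.e. $a,c$ are not both $0$, and $b,d$ are not both $0$). Let $f\in F$ be a non-trivial element such that $\pi_{ab}(f)=(a,b)$. Then there is an element $g\in F$ such that $\pi_{ab}(g)=(c,d)$ and such that $$\langle f,g\rangle=\pi_{ab}^{-1}\big(\langle (a,b),(c,d)\rangle\big),$$ where $\langle (a,b),(c,d)\rangle$ is the subgroup of $\mathbb{Z}^2$ generated by $(a,b)$ and $(c,d)$.
   Context: Thompson's group $F$ is the group (under composition) of all piecewise-linear homeomorphisms of the interval $[0,1]$ with finitely many breakpoints, where all breakpoints are dyadic fractions (numbers in $\mathbb{Z}[\frac12]\cap(0,1)$) and all slopes are integer powers of $2$. (In particular its elements fix $0$ and $1$.) The standard abelianization map $\pi_{ab}\colon F\to\mathbb{Z}^2$ is the surjective homomorphism $\pi_{ab}(f)=(\log_2 f'(0^+),\log_2 f'(1^-))$, whose kernel is the derived subgroup $[F,F]$. *)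

theory Defs
  imports
    "HOL-Analysis.Analysis"
    "HOL-Algebra.Bij"
    "HOL-Algebra.Elementary_Groups"
begin

definition dyadic_rationals :: "real set" where
  "dyadic_rationals = {of_int m / 2 ^ n | m n. True}"

text \<open>
  The finite set \<open>B\<close> contains all breakpoints of \<open>f\<close>: on each subinterval of the
  unit interval with no point of \<open>B\<close> in its interior, \<open>f\<close> is affine, and its slope there
  is an integer power of 2.
\<close>

definition dyadic_piecewise_linear :: "(real \<Rightarrow> real) \<Rightarrow> bool" where
  "dyadic_piecewise_linear f \<longleftrightarrow>
     (\<exists>B. finite B \<and> B \<subseteq> dyadic_rationals \<inter> {0<..<1} \<and>
       (\<forall>u v. 0 \<le> u \<and> u < v \<and> v \<le> 1 \<and> {u<..<v} \<inter> B = {} \<longrightarrow>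
         (\<exists>(k::int) c. \<forall>x\<in>{u..v}. f x = 2 powi k * x + c)))"

text \<open>
  A homeomorphism of the unit interval is represented by its extensional version (the value
  outside the interval is \<open>undefined\<close>), so equality of representatives is equality of maps on
  the interval. The multiplication inherited from \<^const>\<open>BijGroup\<close> is composition.
\<close>

definition thompson_F :: "(real \<Rightarrow> real) monoid" where
  "thompson_F = BijGroup {0..1}
     \<lparr>carrier := {f \<in> Bij {0..1}.
        (\<exists>g. homeomorphism {0..1} {0..1} f g) \<and> dyadic_piecewise_linear f}\<rparr>"

text \<open>
  On Thompson's group both one-sided derivatives are integer powers of 2, so the floor is only
  a coercion from \<^typ>\<open>real\<close> to \<^typ>\<open>int\<close>.
\<close>

definition pi_ab :: "(real \<Rightarrow> real) \<Rightarrow> int \<times> int" where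
  "pi_ab f = (\<lfloor>log 2 (vector_derivative f (at_right 0))\<rfloor>,
              \<lfloor>log 2 (vector_derivative f (at_left 1))\<rfloor>)"

abbreviation Z2 :: "(int \<times> int) monoid" where
  "Z2 \<equiv> integer_group \<times>\<times> integer_group"

end

theory Submission
  imports Defs
begin

text \<open>
  Write \<open>K\<close> for the kernel of \<^const>\<open>pi_ab\<close>: it consists of the elements that are the identity near
  both end points. If the subgroup \<open>H\<close> generated by \<open>f\<close> and \<open>g\<close> contains \<open>K\<close>, then \<open>H\<close> is the full
  preimage of its image, and the theorem follows. So \<open>g\<close> has to be chosen with \<open>K \<subseteq> H\<close>. Replacing
  \<open>g\<close> by \<open>f\<^sup>n g\<close> does not change \<open>H\<close> and replaces \<open>(c, d)\<close> by \<open>(c + n a, d + n b)\<close>; hence one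
  may assume that \<open>c\<close> and \<open>d\<close> are both nonzero, so that \<open>g\<close> can move all points near 0 and near 1.

  \<^emph>\<open>Choice of\<close> \<open>g\<close> (lemma \<open>partner_up\<close>). Up to inverting \<open>f\<close>, there is a short dyadic interval
  \<open>I = [a, b]\<close> that \<open>f\<close> moves off itself to the right. Thompson's group is generated by two elements
  \<open>x\<close>, \<open>y\<close>. Let \<open>g\<close> act on \<open>I\<close> as a scaled copy of \<open>x\<close>, and on \<open>f I\<close> as the conjugate by \<open>f\<close> of a
  scaled copy of \<open>y\<close>. Then \<open>g\<close> and \<open>f\<^sup>-\<^sup>1 g f\<close> both preserve \<open>I\<close> and restrict there to the two
  generators, so every copy on \<open>I\<close> of an element of Thompson's group is the restriction of an element
  of \<open>H\<close>, whose behaviour off \<open>I\<close> is not controlled. The remaining freedom in \<open>g\<close> (bumps next to 0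
  and 1 with the required slopes, and a bump beyond \<open>f I\<close>) is used so that \<open>H\<close> has no fixed
  point in \<open>(0, 1)\<close> and the stabiliser of \<open>b\<close> in \<open>H\<close> has none in \<open>(0, a]\<close>.

  \<^emph>\<open>Compression\<close> (lemma \<open>compress\<close>). By the absence of fixed points, an element of \<open>H\<close> moves the right
  end of a given compact interval below \<open>b\<close>, and then an element of the stabiliser of \<open>b\<close> moves the
  left end above \<open>a\<close>. So every compact subinterval of \<open>(0, 1)\<close> is carried into \<open>I\<close> by \<open>H\<close>, and by
  conjugation every \<open>u \<in> K\<close> agrees with an element of \<open>H\<close> on any prescribed compact subinterval
  (lemma \<open>agree_on_window\<close>).

  \<^emph>\<open>From agreement to membership.\<close> Let \<open>u, v \<in> K\<close>. If \<open>k \<in> H \<inter> K\<close> agrees with \<open>u\<close> on an interval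
  carrying \<open>u\<close> and \<open>v\<close>, and \<open>m \<in> H\<close> agrees with \<open>v\<close> on an interval carrying \<open>k\<close>, then outside the
  first interval the supports of \<open>k\<close> and \<open>m\<close> are disjoint, so \<open>[k, m] = [u, v]\<close>
  (lemma \<open>commutator_local\<close>). Thus \<open>H\<close> contains many commutators. By the pentagon relation between
  tree rotations, a small copy of \<open>x\<close> is a product of two such commutators
  (lemma \<open>rot_commutators\<close>). Hence \<open>H\<close> contains the copies of \<open>x\<close> and \<open>y\<close> on \<open>I\<close>, therefore
  everything supported in \<open>I\<close>, and by compression all of \<open>K\<close>.

  The group elements are handled as functions on the whole real line that are the identity outside
  the unit interval, so that scaled copies and conjugates are plain compositions.
\<close>

section \<open>Dyadic piecewise linear homeomorphisms of the line\<close>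

text \<open>
  The bare prefix \<open>inv\<close> parses as the inverse of an abstract group, hence a name for
  inverse functions.
\<close>

abbreviation finv :: "(real \<Rightarrow> real) \<Rightarrow> real \<Rightarrow> real" where
  "finv \<equiv> inv_into UNIV"

lemma dyadic_of_int [simp]: "of_int m \<in> dyadic_rationals"
  unfolding dyadic_rationals_def by (rule CollectI, rule exI[of _ m], rule exI[of _ 0]) simp

lemma dyadic_add: "x \<in> dyadic_rationals \<Longrightarrow> y \<in> dyadic_rationals \<Longrightarrow> x + y \<in> dyadic_rationals"
proof -
  assume "x \<in> dyadic_rationals" "y \<in> dyadic_rationals"
  then obtain m n m' n' where "x = of_int m / 2 ^ n" "y = of_int m' / 2 ^ n'"
    unfolding dyadic_rationals_def by blast
  then have "x + y = of_int (m * 2 ^ n' + m' * 2 ^ n) / 2 ^ (n + n')"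
    by (simp add: power_add add_divide_distrib)
  then show ?thesis unfolding dyadic_rationals_def by blast
qed

lemma dyadic_mult: "x \<in> dyadic_rationals \<Longrightarrow> y \<in> dyadic_rationals \<Longrightarrow> x * y \<in> dyadic_rationals"
proof -
  assume "x \<in> dyadic_rationals" "y \<in> dyadic_rationals"
  then obtain m n m' n' where "x = of_int m / 2 ^ n" "y = of_int m' / 2 ^ n'"
    unfolding dyadic_rationals_def by blast
  then have "x * y = of_int (m * m') / 2 ^ (n + n')"
    by (simp add: power_add)
  then show ?thesis unfolding dyadic_rationals_def by blast
qed

lemma dyadic_diff: "x \<in> dyadic_rationals \<Longrightarrow> y \<in> dyadic_rationals \<Longrightarrow> x - y \<in> dyadic_rationals"
  using dyadic_add[of x "- y"] dyadic_mult[of "of_int (- 1)" y] dyadic_of_int[of "- 1"] by simp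

lemma dyadic_powi [simp]: "2 powi k \<in> dyadic_rationals"
proof (cases "0 \<le> k")
  case True
  then have "(2::real) powi k = of_int (2 ^ nat k)" by (simp add: power_int_def)
  then show ?thesis using dyadic_of_int by metis
next
  case False
  then have "(2::real) powi k = of_int 1 / 2 ^ nat (- k)" by (simp add: power_int_def field_simps)
  then show ?thesis unfolding dyadic_rationals_def by blast
qed

lemma dyadic_simps [simp]:
  "0 \<in> dyadic_rationals" "1 \<in> dyadic_rationals" "numeral w \<in> dyadic_rationals"
  "1 / 2 \<in> dyadic_rationals" "1 / 4 \<in> dyadic_rationals"
  using dyadic_of_int[of 0] dyadic_of_int[of 1] dyadic_of_int[of "numeral w"]
    dyadic_powi[of "- 1"] dyadic_powi[of "- 2"]
  by (simp_all add: power_int_minus field_simps)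

lemma dyadic_affine_iff:
  assumes "y \<in> dyadic_rationals" "x \<in> dyadic_rationals"
  shows "y + 2 powi k * (z - x) \<in> dyadic_rationals \<longleftrightarrow> z \<in> dyadic_rationals"
proof
  assume "z \<in> dyadic_rationals"
  then show "y + 2 powi k * (z - x) \<in> dyadic_rationals"
    using assms by (intro dyadic_add dyadic_mult dyadic_diff) auto
next
  assume *: "y + 2 powi k * (z - x) \<in> dyadic_rationals"
  have "x + 2 powi (- k) * ((y + 2 powi k * (z - x)) - y) \<in> dyadic_rationals"
    by (intro dyadic_add[OF assms(2)] dyadic_mult dyadic_powi dyadic_diff[OF * assms(1)])
  moreover have "x + 2 powi (- k) * ((y + 2 powi k * (z - x)) - y) = z"
    by (simp add: power_int_minus field_simps)
  ultimately show "z \<in> dyadic_rationals" by (simp only:)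
qed

text \<open>
  Affine pieces are taken on the whole line, so the end points of an interval that supports a function
  may be breaks as well.
\<close>

definition breaks_in :: "real set \<Rightarrow> (real \<Rightarrow> real) \<Rightarrow> bool" where
  "breaks_in B f \<longleftrightarrow> (\<forall>u v. u < v \<and> {u<..<v} \<inter> B = {} \<longrightarrow>
     (\<exists>(k::int) c. \<forall>x\<in>{u..v}. f x = 2 powi k * x + c))"

text \<open>
  For \<open>a = 0\<close>, \<open>b = 1\<close> this is Thompson's group, acting on the line by the identity off the unit
  interval.
\<close>

definition F_on :: "real \<Rightarrow> real \<Rightarrow> (real \<Rightarrow> real) set" where
  "F_on a b = {f. bij f \<and> (\<exists>B. finite B \<and> B \<subseteq> dyadic_rationals \<and> breaks_in B f) \<and>
                  (\<forall>x. x \<notin> {a<..<b} \<longrightarrow> f x = x)}"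

lemma breaks_inD:
  assumes "breaks_in B f" "u < v" "{u<..<v} \<inter> B = {}"
  obtains k where "\<And>x. u \<le> x \<Longrightarrow> x \<le> v \<Longrightarrow> f x = f u + 2 powi k * (x - u)"
proof -
  obtain k c where *: "\<And>x. x \<in> {u..v} \<Longrightarrow> f x = 2 powi k * x + c"
    using assms unfolding breaks_in_def by blast
  have "f x = f u + 2 powi k * (x - u)" if "u \<le> x" "x \<le> v" for x
    using *[of x] *[of u] that assms(2) by (simp add: algebra_simps)
  then show ?thesis using that by blast
qed

lemma breaks_inI:
  assumes "\<And>u v. u < v \<Longrightarrow> {u<..<v} \<inter> B = {} \<Longrightarrow>
     \<exists>(k::int) c. \<forall>x\<in>{u..v}. f x = 2 powi k * x + c"
  shows "breaks_in B f"
  using assms unfolding breaks_in_def by blast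

text \<open>
  Slopes are powers of 2, hence positive; the value at a break is shared by the two adjacent pieces.
  The induction is on the number of breaks between the two points.
\<close>

lemma breaks_in_strict_mono:
  assumes "breaks_in B f" "finite B"
  shows "strict_mono f"
proof -
  have "x < y \<Longrightarrow> f x < f y" for x y
  proof (induction "card (B \<inter> {x<..<y})" arbitrary: x y rule: less_induct)
    case less
    show ?case
    proof (cases "{x<..<y} \<inter> B = {}")
      case True
      from breaks_inD[OF assms(1) less.prems True] obtain k
        where "\<And>z. x \<le> z \<Longrightarrow> z \<le> y \<Longrightarrow> f z = f x + 2 powi k * (z - x)" by blast
      from this[of y] less.prems show ?thesis by simp
    next
      case False
      then obtain b where b: "b \<in> B" "x < b" "b < y" by auto
      have "card (B \<inter> {x<..<b}) < card (B \<inter> {x<..<y})"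
        using b assms(2) by (intro psubset_card_mono) auto
      moreover have "card (B \<inter> {b<..<y}) < card (B \<inter> {x<..<y})"
        using b assms(2) by (intro psubset_card_mono) auto
      ultimately show ?thesis using less.hyps b by (meson less_trans)
    qed
  qed
  then show ?thesis by (simp add: strict_monoI)
qed

lemma F_onE:
  assumes "f \<in> F_on a b"
  obtains B where "finite B" "B \<subseteq> dyadic_rationals" "breaks_in B f"
  using assms unfolding F_on_def by blast

lemma F_on_bij: "f \<in> F_on a b \<Longrightarrow> bij f"
  and F_on_fix: "f \<in> F_on a b \<Longrightarrow> x \<notin> {a<..<b} \<Longrightarrow> f x = x"
  unfolding F_on_def by blast+

lemma F_on_strict_mono: "f \<in> F_on a b \<Longrightarrow> strict_mono f"
  using F_onE breaks_in_strict_mono by metis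

lemma F_on_inv [simp]:
  assumes "f \<in> F_on a b"
  shows "f (finv f x) = x" "finv f (f x) = x" "f \<circ> finv f = id" "finv f \<circ> f = id"
  using F_on_bij[OF assms] by (auto simp: bij_is_surj surj_f_inv_f bij_is_inj fun_eq_iff)

lemma F_on_less [simp]: "f \<in> F_on a b \<Longrightarrow> f x < f y \<longleftrightarrow> x < y"
  and F_on_le [simp]: "f \<in> F_on a b \<Longrightarrow> f x \<le> f y \<longleftrightarrow> x \<le> y"
  using F_on_strict_mono strict_mono_less strict_mono_less_eq by blast+

lemma F_on_maps:
  assumes "f \<in> F_on a b"
  shows "x \<in> {a<..<b} \<Longrightarrow> f x \<in> {a<..<b}" "x \<in> {a..b} \<Longrightarrow> f x \<in> {a..b}"
proof -
  have ab: "f a = a" "f b = b" using F_on_fix[OF assms] by auto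
  show "x \<in> {a<..<b} \<Longrightarrow> f x \<in> {a<..<b}"
    using F_on_less[OF assms, of a x] F_on_less[OF assms, of x b] ab by auto
  show "x \<in> {a..b} \<Longrightarrow> f x \<in> {a..b}"
    using F_on_le[OF assms, of a x] F_on_le[OF assms, of x b] ab by auto
qed

lemma F_on_mono: "f \<in> F_on a b \<Longrightarrow> c \<le> a \<Longrightarrow> b \<le> d \<Longrightarrow> f \<in> F_on c d"
  unfolding F_on_def by auto

text \<open>
  Breaks and slopes are dyadic by definition, but the constant terms of the affine pieces are not
  mentioned there. They are dyadic because the function fixes a dyadic point (an integer far to the
  left) and one can pass from there from break to break. This is what makes the breaks of composites
  and inverses dyadic.
\<close>

lemma F_on_dyadic_iff:
  assumes f: "f \<in> F_on a b"
  shows "f x \<in> dyadic_rationals \<longleftrightarrow> x \<in> dyadic_rationals"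
proof -
  obtain B where B: "finite B" "B \<subseteq> dyadic_rationals" "breaks_in B f"
    using F_onE[OF f] .
  define z :: real where "z = of_int (\<lfloor>min a x\<rfloor> - 1)"
  have z: "z \<in> dyadic_rationals" "z < a" "z < x"
    unfolding z_def using dyadic_of_int by (blast, linarith, linarith)
  have fz: "f z = z" using F_on_fix[OF f, of z] z by simp
  have "z < y \<Longrightarrow> f y \<in> dyadic_rationals \<longleftrightarrow> y \<in> dyadic_rationals" for y
  proof (induction "card (B \<inter> {z<..<y})" arbitrary: y rule: less_induct)
    case less
    show ?case
    proof (cases "{z<..<y} \<inter> B = {}")
      case True
      from breaks_inD[OF B(3) less.prems True] obtain k
        where "\<And>x. z \<le> x \<Longrightarrow> x \<le> y \<Longrightarrow> f x = f z + 2 powi k * (x - z)" by blast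
      from this[of y] less.prems show ?thesis
        using dyadic_affine_iff[OF z(1) z(1)] fz by simp
    next
      case False
      define b where "b = Max (B \<inter> {z<..<y})"
      have fin: "finite (B \<inter> {z<..<y})" and ne: "B \<inter> {z<..<y} \<noteq> {}" using B(1) False by auto
      have b: "b \<in> B" "z < b" "b < y" using Max_in[OF fin ne] unfolding b_def by auto
      have e: "{b<..<y} \<inter> B = {}"
      proof (rule ccontr)
        assume "{b<..<y} \<inter> B \<noteq> {}"
        then obtain t where "t \<in> B" "b < t" "t < y" by auto
        moreover from this have "t \<le> b"
          unfolding b_def using fin b(2) by (intro Max_ge) (auto simp: b_def[symmetric])
        ultimately show False by simp
      qed
      have "card (B \<inter> {z<..<b}) < card (B \<inter> {z<..<y})"
        using b B(1) by (intro psubset_card_mono) auto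
      from less.hyps[OF this b(2)] have fb: "f b \<in> dyadic_rationals" using b B(2) by auto
      from breaks_inD[OF B(3) b(3) e] obtain k
        where "\<And>x. b \<le> x \<Longrightarrow> x \<le> y \<Longrightarrow> f x = f b + 2 powi k * (x - b)" by blast
      from this[of y] b show ?thesis
        using dyadic_affine_iff[OF fb, of b] B(2) by auto
    qed
  qed
  then show ?thesis using z(3) .
qed

lemma id_in_F_on [simp]: "id \<in> F_on a b"
proof -
  have "breaks_in {} id"
    by (rule breaks_inI, rule exI[of _ 0], rule exI[of _ 0]) simp
  then show ?thesis unfolding F_on_def by (auto intro!: exI[of _ "{}"])
qed

lemma F_on_comp:
  assumes f: "f \<in> F_on a b" and g: "g \<in> F_on a b"
  shows "g \<circ> f \<in> F_on a b"
proof -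
  obtain B where B: "finite B" "B \<subseteq> dyadic_rationals" "breaks_in B f"
    using F_onE[OF f] .
  obtain C where C: "finite C" "C \<subseteq> dyadic_rationals" "breaks_in C g"
    using F_onE[OF g] .
  have "breaks_in (B \<union> f -` C) (g \<circ> f)"
  proof (rule breaks_inI)
    fix u v :: real assume uv: "u < v" and e: "{u<..<v} \<inter> (B \<union> f -` C) = {}"
    then have "{u<..<v} \<inter> B = {}" by blast
    then obtain k c where 1: "\<And>x. x \<in> {u..v} \<Longrightarrow> f x = 2 powi k * x + c"
      using B(3) uv unfolding breaks_in_def by metis
    have "{f u<..<f v} \<inter> C = {}"
    proof (rule ccontr)
      assume "{f u<..<f v} \<inter> C \<noteq> {}"
      then obtain y where y: "y \<in> C" "f u < y" "y < f v" by auto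
      then have "finv f y \<in> {u<..<v} \<inter> f -` C"
        using F_on_less[OF f, of u "finv f y"] F_on_less[OF f, of "finv f y" v] f by auto
      then show False using e by blast
    qed
    then obtain k' c' where 2: "\<And>x. x \<in> {f u..f v} \<Longrightarrow> g x = 2 powi k' * x + c'"
      using C(3) uv f unfolding breaks_in_def by (metis F_on_less)
    have "(g \<circ> f) x = 2 powi (k' + k) * x + (2 powi k' * c + c')" if "x \<in> {u..v}" for x
    proof -
      have "f x \<in> {f u..f v}" using that f by simp
      from 2[OF this] show ?thesis
        unfolding comp_def 1[OF that] by (simp add: power_int_add algebra_simps)
    qed
    then show "\<exists>k c. \<forall>x\<in>{u..v}. (g \<circ> f) x = 2 powi k * x + c" by blast
  qed
  moreover have "finite (B \<union> f -` C)" using B(1) C(1) F_on_bij[OF f]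
    by (auto intro: finite_vimageI bij_is_inj)
  moreover have "B \<union> f -` C \<subseteq> dyadic_rationals" using B(2) C(2) F_on_dyadic_iff[OF f] by auto
  moreover have "bij (g \<circ> f)" using F_on_bij f g bij_comp by blast
  moreover have "\<forall>x. x \<notin> {a<..<b} \<longrightarrow> (g \<circ> f) x = x"
    using F_on_fix[OF f] F_on_fix[OF g] by simp
  ultimately show ?thesis unfolding F_on_def by blast
qed

lemma F_on_inverse:
  assumes f: "f \<in> F_on a b"
  shows "finv f \<in> F_on a b"
proof -
  obtain B where B: "finite B" "B \<subseteq> dyadic_rationals" "breaks_in B f"
    using F_onE[OF f] .
  have "breaks_in (f ` B) (finv f)"
  proof (rule breaks_inI)
    fix u v :: real assume uv: "u < v" and e: "{u<..<v} \<inter> f ` B = {}"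
    have uv': "finv f u < finv f v" using F_on_less[OF f, of "finv f u" "finv f v"] uv f by simp
    have "{finv f u<..<finv f v} \<inter> B = {}"
    proof (rule ccontr)
      assume "{finv f u<..<finv f v} \<inter> B \<noteq> {}"
      then obtain y where y: "y \<in> B" "finv f u < y" "y < finv f v" by auto
      then have "f y \<in> {u<..<v} \<inter> f ` B"
        using F_on_less[OF f, of "finv f u" y] F_on_less[OF f, of y "finv f v"] f by auto
      then show False using e by blast
    qed
    then obtain k c where 1: "\<And>x. x \<in> {finv f u..finv f v} \<Longrightarrow> f x = 2 powi k * x + c"
      using B(3) uv' unfolding breaks_in_def by metis
    have "finv f y = 2 powi (- k) * y + (- (2 powi (- k) * c))" if "y \<in> {u..v}" for y
    proof -
      have "finv f y \<in> {finv f u..finv f v}"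
        using that F_on_le[OF f, of "finv f u" "finv f y"] F_on_le[OF f, of "finv f y" "finv f v"] f
        by simp
      from 1[OF this] have "y = 2 powi k * finv f y + c" using f by simp
      then show ?thesis by (simp add: power_int_minus field_simps)
    qed
    then show "\<exists>k c. \<forall>x\<in>{u..v}. finv f x = 2 powi k * x + c" by blast
  qed
  moreover have "finite (f ` B)" using B(1) by simp
  moreover have "f ` B \<subseteq> dyadic_rationals" using B(2) F_on_dyadic_iff[OF f] by auto
  moreover have "bij (finv f)" using F_on_bij f bij_imp_bij_inv by blast
  moreover have "\<forall>x. x \<notin> {a<..<b} \<longrightarrow> finv f x = x"
    using F_on_fix[OF f] f by (metis F_on_inv(2))
  ultimately show ?thesis unfolding F_on_def by blast
qed

lemma F_on_conj:
  assumes h: "h \<in> F_on a b" and f: "f \<in> F_on c d" "f \<in> F_on a b"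
  shows "h \<circ> f \<circ> finv h \<in> F_on (h c) (h d)"
proof -
  have "(h \<circ> f \<circ> finv h) x = x" if "x \<notin> {h c<..<h d}" for x
  proof -
    have "finv h x \<notin> {c<..<d}"
      using that F_on_less[OF h, of c "finv h x"] F_on_less[OF h, of "finv h x" d] h by auto
    then show ?thesis using F_on_fix[OF f(1)] h by simp
  qed
  moreover have "h \<circ> f \<circ> finv h \<in> F_on a b"
    using F_on_comp F_on_inverse h f by metis
  ultimately show ?thesis unfolding F_on_def by blast
qed

text \<open>
  The conjugate of \<open>f\<close> by \<open>x \<mapsto> p + l x\<close>: the copy on \<open>[p, p + l]\<close> of a function supported in the
  unit interval.
\<close>

definition rescale :: "real \<Rightarrow> real \<Rightarrow> (real \<Rightarrow> real) \<Rightarrow> real \<Rightarrow> real" where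
  "rescale p l f = (\<lambda>x. p + l * f ((x - p) / l))"

lemma rescale_comp: "l \<noteq> 0 \<Longrightarrow> rescale p l (f \<circ> g) = rescale p l f \<circ> rescale p l g"
  by (simp add: rescale_def fun_eq_iff)

lemma rescale_id [simp]: "l \<noteq> 0 \<Longrightarrow> rescale p l id = id"
  by (simp add: rescale_def fun_eq_iff)

lemma rescale_rescale: "l \<noteq> 0 \<Longrightarrow> m \<noteq> 0 \<Longrightarrow> rescale p l (rescale q m f) = rescale (p + l * q) (l * m) f"
proof -
  assume "l \<noteq> 0" "m \<noteq> 0"
  then have "((x - p) / l - q) / m = (x - (p + l * q)) / (l * m)" for x
    by (simp add: field_simps)
  then show ?thesis by (simp add: rescale_def fun_eq_iff algebra_simps)
qed

lemma rescale_unit [simp]: "rescale 0 1 f = f"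
  by (simp add: rescale_def fun_eq_iff)

lemma rescale_rescale_finv:
  assumes "bij f" "l \<noteq> 0"
  shows "rescale p l f \<circ> rescale p l (finv f) = id" "rescale p l (finv f) \<circ> rescale p l f = id"
proof -
  have "f \<circ> finv f = id" "finv f \<circ> f = id"
    using assms(1) by (auto simp: fun_eq_iff bij_is_surj surj_f_inv_f bij_is_inj)
  then show "rescale p l f \<circ> rescale p l (finv f) = id" "rescale p l (finv f) \<circ> rescale p l f = id"
    using assms(2) by (simp_all flip: rescale_comp)
qed

lemma rescale_bij: "bij f \<Longrightarrow> l \<noteq> 0 \<Longrightarrow> bij (rescale p l f)"
  using rescale_rescale_finv o_bij by metis

lemma rescale_inv: "bij f \<Longrightarrow> l \<noteq> 0 \<Longrightarrow> finv (rescale p l f) = rescale p l (finv f)"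
  using rescale_rescale_finv inv_unique_comp by metis

lemma rescale_in_F_on:
  assumes f: "f \<in> F_on a b" and p: "p \<in> dyadic_rationals" and l: "l \<in> dyadic_rationals" "0 < l"
  shows "rescale p l f \<in> F_on (p + l * a) (p + l * b)"
proof -
  obtain B where B: "finite B" "B \<subseteq> dyadic_rationals" "breaks_in B f"
    using F_onE[OF f] .
  have "breaks_in ((\<lambda>x. p + l * x) ` B) (rescale p l f)"
  proof (rule breaks_inI)
    fix u v :: real assume uv: "u < v" and e: "{u<..<v} \<inter> (\<lambda>x. p + l * x) ` B = {}"
    have uv': "(u - p) / l < (v - p) / l" using uv l by (simp add: divide_strict_right_mono)
    have "{(u - p) / l<..<(v - p) / l} \<inter> B = {}"
    proof (rule ccontr)
      assume "{(u - p) / l<..<(v - p) / l} \<inter> B \<noteq> {}"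
      then obtain y where y: "y \<in> B" "(u - p) / l < y" "y < (v - p) / l" by auto
      then have "p + l * y \<in> {u<..<v} \<inter> (\<lambda>x. p + l * x) ` B"
        using l by (auto simp: field_simps)
      then show False using e by blast
    qed
    then obtain k c where 1: "\<And>x. x \<in> {(u - p) / l..(v - p) / l} \<Longrightarrow> f x = 2 powi k * x + c"
      using B(3) uv' unfolding breaks_in_def by metis
    have "rescale p l f x = 2 powi k * x + (p - 2 powi k * p + l * c)" if "x \<in> {u..v}" for x
    proof -
      have "(x - p) / l \<in> {(u - p) / l..(v - p) / l}" using that l by (simp add: divide_right_mono)
      from 1[OF this] show ?thesis using l by (simp add: rescale_def field_simps)
    qed
    then show "\<exists>k c. \<forall>x\<in>{u..v}. rescale p l f x = 2 powi k * x + c" by blast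
  qed
  moreover have "finite ((\<lambda>x. p + l * x) ` B)" using B(1) by simp
  moreover have "(\<lambda>x. p + l * x) ` B \<subseteq> dyadic_rationals"
    using B(2) p l by (auto intro!: dyadic_add dyadic_mult)
  moreover have "bij (rescale p l f)" using F_on_bij[OF f] l rescale_bij by simp
  moreover have "\<forall>x. x \<notin> {p + l * a<..<p + l * b} \<longrightarrow> rescale p l f x = x"
  proof (intro allI impI)
    fix x assume "x \<notin> {p + l * a<..<p + l * b}"
    then have "(x - p) / l \<notin> {a<..<b}" using l by (auto simp: field_simps)
    then show "rescale p l f x = x" using F_on_fix[OF f] l by (simp add: rescale_def)
  qed
  ultimately show ?thesis unfolding F_on_def by blast
qed

text \<open>
  The source of all conjugation relations below: \<open>h\<close> need only be affine on the interval that carries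
  the copy.
\<close>

lemma conj_rescale:
  assumes h: "strict_mono h" and f: "f \<in> F_on 0 1" and l: "0 < l" "0 < m"
    and aff: "\<And>y. 0 \<le> y \<Longrightarrow> y \<le> 1 \<Longrightarrow> h (p + l * y) = q + m * y"
  shows "h \<circ> rescale p l f = rescale q m f \<circ> h"
proof
  fix x
  define y where "y = (x - p) / l"
  have x: "x = p + l * y" using l by (simp add: y_def)
  show "(h \<circ> rescale p l f) x = (rescale q m f \<circ> h) x"
  proof (cases "0 \<le> y \<and> y \<le> 1")
    case True
    then show ?thesis using aff[of y] aff[of "f y"] F_on_maps(2)[OF f, of y] l
      by (simp add: rescale_def x)
  next
    case False
    then have "f y = y" using F_on_fix[OF f, of y] by auto
    moreover have "(h x - q) / m \<notin> {0<..<1}"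
    proof -
      have "h p = q" "h (p + l) = q + m" using aff[of 0] aff[of 1] by auto
      moreover have "x < p \<or> p + l < x" using False l by (auto simp: x not_le mult_less_0_iff)
      ultimately have "h x < q \<or> q + m < h x" using h by (metis strict_mono_less)
      then show ?thesis using l by (auto simp: field_simps)
    qed
    ultimately show ?thesis using F_on_fix[OF f] l by (simp add: rescale_def x)
  qed
qed

section \<open>Generating Thompson's group by two copies of one element\<close>

text \<open>
  The standard generator \<open>x\<^sub>0\<close>. In terms of binary trees it is the rotation at the root: it carries
  the intervals \<open>[0, 1/4]\<close>, \<open>[1/4, 1/2]\<close>, \<open>[1/2, 1]\<close> affinely onto \<open>[0, 1/2]\<close>, \<open>[1/2, 3/4]\<close>,
  \<open>[3/4, 1]\<close>.
\<close>

definition rot :: "real \<Rightarrow> real" where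
  "rot x = (if x \<le> 0 \<or> 1 \<le> x then x else if x \<le> 1/4 then 2 * x
            else if x \<le> 1/2 then x + 1/4 else (x + 1) / 2)"

lemma rot_in_F_on: "rot \<in> F_on 0 1"
proof -
  define s :: "real \<Rightarrow> real" where
    "s = (\<lambda>y. if y \<le> 0 \<or> 1 \<le> y then y else if y \<le> 1/2 then y / 2
            else if y \<le> 3/4 then y - 1/4 else 2 * y - 1)"
  have "rot \<circ> s = id" "s \<circ> rot = id"
    by (auto simp: fun_eq_iff rot_def s_def field_simps)
  then have "bij rot" using o_bij by blast
  moreover have "breaks_in {0, 1/4, 1/2, 1} rot"
  proof (rule breaks_inI)
    fix u v :: real assume uv: "u < v" and e: "{u<..<v} \<inter> {0, 1/4, 1/2, 1} = {}"
    consider "v \<le> 0" | "0 \<le> u" "v \<le> 1/4" | "1/4 \<le> u" "v \<le> 1/2" | "1/2 \<le> u" "v \<le> 1" | "1 \<le> u"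
      using e uv by fastforce
    then show "\<exists>k c. \<forall>x\<in>{u..v}. rot x = 2 powi k * x + c"
    proof cases
      case 1 then show ?thesis by (intro exI[of _ 0] exI[of _ 0]) (auto simp: rot_def)
    next
      case 2 then show ?thesis by (intro exI[of _ 1] exI[of _ 0]) (auto simp: rot_def)
    next
      case 3 then show ?thesis by (intro exI[of _ 0] exI[of _ "1/4"]) (auto simp: rot_def)
    next
      case 4 then show ?thesis
        by (intro exI[of _ "- 1"] exI[of _ "1/2"]) (auto simp: rot_def power_int_minus field_simps)
    next
      case 5 then show ?thesis by (intro exI[of _ 0] exI[of _ 0]) (auto simp: rot_def)
    qed
  qed
  moreover have "finite {0, 1/4, 1/2, 1 :: real}" "{0, 1/4, 1/2, 1} \<subseteq> dyadic_rationals" by auto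
  moreover have "\<forall>x. x \<notin> {0<..<1} \<longrightarrow> rot x = x" by (auto simp: rot_def)
  ultimately show ?thesis unfolding F_on_def by blast
qed

lemma rot_greater: "0 < x \<Longrightarrow> x < 1 \<Longrightarrow> x < rot x"
  by (auto simp: rot_def)

abbreviation lft :: "(real \<Rightarrow> real) \<Rightarrow> real \<Rightarrow> real" where "lft \<equiv> rescale 0 (1/2)"
abbreviation rgt :: "(real \<Rightarrow> real) \<Rightarrow> real \<Rightarrow> real" where "rgt \<equiv> rescale (1/2) (1/2)"

lemma lft_in_F_on: "f \<in> F_on 0 1 \<Longrightarrow> lft f \<in> F_on 0 (1/2)"
  and rgt_in_F_on: "f \<in> F_on 0 1 \<Longrightarrow> rgt f \<in> F_on (1/2) 1"
  using rescale_in_F_on[of f 0 1 0 "1/2"] rescale_in_F_on[of f 0 1 "1/2" "1/2"] by simp_all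

lemma lft_rgt_unit: "f \<in> F_on 0 1 \<Longrightarrow> lft f \<in> F_on 0 1" "f \<in> F_on 0 1 \<Longrightarrow> rgt f \<in> F_on 0 1"
  using F_on_mono[OF lft_in_F_on, of f 0 1] F_on_mono[OF rgt_in_F_on, of f 0 1] by simp_all

text \<open>
  A tree stands for the dyadic subdivision of the unit interval obtained by halving at each inner
  node.
\<close>

datatype tree = Leaf | Node tree tree

fun leaves :: "tree \<Rightarrow> nat" where
  "leaves Leaf = 1"
| "leaves (Node l r) = leaves l + leaves r"

text \<open>
  The chart of a tree stretches its \<open>i\<close>-th leaf interval (counted from 0) affinely onto \<open>[i, i + 1]\<close>.
  An element of Thompson's group described by a pair of trees \<open>(T, S)\<close> is the \<open>h\<close> with
  \<open>chart T x = chart S (h x)\<close>, so charts turn the composition of tree pairs into substitution.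
\<close>

fun chart :: "tree \<Rightarrow> real \<Rightarrow> real" where
  "chart Leaf x = x"
| "chart (Node l r) x = (if x \<le> 1/2 then chart l (2 * x) else leaves l + chart r (2 * x - 1))"

lemma chart_ends [simp]: "chart T 0 = 0" "chart T 1 = leaves T"
  by (induction T) auto

lemma chart_less: "0 \<le> x \<Longrightarrow> x < y \<Longrightarrow> y \<le> 1 \<Longrightarrow> chart T x < chart T y"
proof (induction T arbitrary: x y)
  case (Node l r)
  consider "y \<le> 1/2" | "x \<le> 1/2" "1/2 < y" | "1/2 < x" by linarith
  then show ?case
  proof cases
    case 1 then show ?thesis using Node.IH(1)[of "2 * x" "2 * y"] Node.prems by simp
  next
    case 2
    then have "chart l (2 * x) \<le> leaves l"
      using Node.IH(1)[of "2 * x" 1] Node.prems by (cases "2 * x = 1") auto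
    moreover have "0 < chart r (2 * y - 1)"
      using Node.IH(2)[of 0 "2 * y - 1"] Node.prems 2 by simp
    ultimately show ?thesis using 2 by simp
  next
    case 3 then show ?thesis using Node.IH(2)[of "2 * x - 1" "2 * y - 1"] Node.prems by simp
  qed
qed simp

lemma chart_inj: "x \<in> {0..1} \<Longrightarrow> y \<in> {0..1} \<Longrightarrow> chart T x = chart T y \<Longrightarrow> x = y"
  using chart_less[of x y T] chart_less[of y x T] by (cases x y rule: linorder_cases) auto

text \<open>
  Closure under \<open>lft\<close> and \<open>rgt\<close> brings in the rotations at all nodes of the binary tree.
\<close>

inductive_set tree_group :: "(real \<Rightarrow> real) set" where
  rot: "rot \<in> tree_group"
| id: "id \<in> tree_group"
| comp: "f \<in> tree_group \<Longrightarrow> g \<in> tree_group \<Longrightarrow> f \<circ> g \<in> tree_group"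
| inverse: "f \<in> tree_group \<Longrightarrow> finv f \<in> tree_group"
| lft: "f \<in> tree_group \<Longrightarrow> lft f \<in> tree_group"
| rgt: "f \<in> tree_group \<Longrightarrow> rgt f \<in> tree_group"

lemma tree_group_F_on: "f \<in> tree_group \<Longrightarrow> f \<in> F_on 0 1"
  by (induction rule: tree_group.induct) (auto intro: rot_in_F_on F_on_inverse lft_rgt_unit
      F_on_comp[unfolded comp_def] id_in_F_on[unfolded id_def])

text \<open>
  The tree pair \<open>(T, S)\<close> represents an element of the group generated by the rotations at all nodes.
\<close>

definition reduces :: "tree \<Rightarrow> tree \<Rightarrow> bool" where
  "reduces T S \<longleftrightarrow> (\<exists>g\<in>tree_group. \<forall>x\<in>{0..1}. chart T x = chart S (g x))"

lemma reduces_refl: "reduces T T"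
  unfolding reduces_def using tree_group.id by (intro bexI[of _ id]) auto

lemma reduces_trans: assumes "reduces T S" "reduces S U" shows "reduces T U"
proof -
  obtain f g where f: "f \<in> tree_group" "\<And>x. x \<in> {0..1} \<Longrightarrow> chart T x = chart S (f x)"
    and g: "g \<in> tree_group" "\<And>x. x \<in> {0..1} \<Longrightarrow> chart S x = chart U (g x)"
    using assms unfolding reduces_def by blast
  have "chart T x = chart U ((g \<circ> f) x)" if "x \<in> {0..1}" for x
    using f(2)[OF that] g(2)[of "f x"] F_on_maps(2)[OF tree_group_F_on[OF f(1)] that] by simp
  then show ?thesis unfolding reduces_def using f g tree_group.comp by blast
qed

lemma reduces_leaves: assumes "reduces T S" shows "leaves T = leaves S"
proof -
  obtain f where f: "f \<in> tree_group" "\<And>x. x \<in> {0..1} \<Longrightarrow> chart T x = chart S (f x)"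
    using assms unfolding reduces_def by blast
  have "f 1 = 1" using F_on_fix[OF tree_group_F_on[OF f(1)]] by simp
  then show ?thesis using f(2)[of 1] by simp
qed

lemma reduces_Node:
  assumes "reduces l l'" "reduces r r'"
  shows "reduces (Node l r) (Node l' r')"
proof -
  obtain f g where f: "f \<in> tree_group" "\<And>x. x \<in> {0..1} \<Longrightarrow> chart l x = chart l' (f x)"
    and g: "g \<in> tree_group" "\<And>x. x \<in> {0..1} \<Longrightarrow> chart r x = chart r' (g x)"
    using assms unfolding reduces_def by blast
  have "chart (Node l r) x = chart (Node l' r') ((rgt g \<circ> lft f) x)" if x: "x \<in> {0..1}" for x
  proof (cases "x \<le> 1/2")
    case True
    then have "f (2 * x) \<in> {0..1}" using F_on_maps(2)[OF tree_group_F_on[OF f(1)], of "2 * x"] x by simp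
    moreover from this have "rgt g (f (2 * x) / 2) = f (2 * x) / 2"
      by (intro F_on_fix[OF rgt_in_F_on[OF tree_group_F_on[OF g(1)]]]) simp
    then have eq: "(rgt g \<circ> lft f) x = f (2 * x) / 2" by (simp add: rescale_def[of 0] mult.commute)
    ultimately show ?thesis unfolding eq using True x f(2)[of "2 * x"] by simp
  next
    case False
    then have "g (2 * x - 1) \<in> {0<..1}"
      using F_on_maps[OF tree_group_F_on[OF g(1)], of "2 * x - 1"] x F_on_fix[OF tree_group_F_on[OF g(1)], of 1]
      by (cases "x = 1") auto
    moreover have "lft f x = x"
      by (intro F_on_fix[OF lft_in_F_on[OF tree_group_F_on[OF f(1)]]]) (use False in simp)
    then have eq: "(rgt g \<circ> lft f) x = 1 / 2 + g (2 * x - 1) / 2"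
      by (simp add: rescale_def[of "1/2"] algebra_simps)
    ultimately show ?thesis unfolding eq using False x g(2)[of "2 * x - 1"] reduces_leaves[OF assms(1)]
      by simp
  qed
  then show ?thesis unfolding reduces_def using tree_group.comp tree_group.lft tree_group.rgt f(1) g(1) by blast
qed

text \<open>
  Rotation matches the three leaves or subtrees \<open>A\<close>, \<open>B\<close>, \<open>C\<close> in order.
\<close>

lemma chart_rot:
  "0 \<le> x \<Longrightarrow> x \<le> 1 \<Longrightarrow> chart (Node (Node A B) C) x = chart (Node A (Node B C)) (rot x)"
proof -
  assume "0 \<le> x" "x \<le> 1"
  then consider "x = 0" | "0 < x" "x \<le> 1/4" | "1/4 < x" "x \<le> 1/2" | "1/2 < x" "x < 1" | "x = 1"
    by linarith
  then show ?thesis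
  proof cases
    case 2
    then show ?thesis by (simp add: rot_def)
  next
    case 3
    then have "rot x = x + 1/4" by (simp add: rot_def)
    with 3 show ?thesis by (simp add: algebra_simps)
  next
    case 4
    then have "rot x = (x + 1) / 2" by (simp add: rot_def)
    with 4 show ?thesis by (simp add: algebra_simps)
  qed (simp_all add: rot_def)
qed

text \<open>
  Combs are the normal form: rotations push every tree to the right.
\<close>

fun comb :: "nat \<Rightarrow> tree" where
  "comb 0 = Leaf"
| "comb (Suc n) = Node Leaf (comb n)"

lemma leaves_comb [simp]: "leaves (comb n) = Suc n"
  by (induction n) auto

lemma reduces_rot: "reduces (Node (Node A B) C) (Node A (Node B C))"
  unfolding reduces_def using chart_rot tree_group.rot by (intro bexI[of _ rot]) auto

lemma reduces_comb_Node: "reduces (Node (comb i) (comb j)) (comb (Suc (i + j)))"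
proof (induction i)
  case 0 then show ?case by (simp add: reduces_refl)
next
  case (Suc i)
  have "reduces (Node (comb (Suc i)) (comb j)) (Node Leaf (Node (comb i) (comb j)))"
    using reduces_rot by simp
  also have "reduces \<dots> (Node Leaf (comb (Suc (i + j))))"
    using Suc reduces_refl reduces_Node by blast
  finally (reduces_trans) show ?case by simp
qed

lemma reduces_to_comb: "\<exists>n. reduces T (comb n)"
proof (induction T)
  case Leaf
  then show ?case using reduces_refl[of Leaf] by (intro exI[of _ 0]) simp
next
  case (Node l r)
  then show ?case using reduces_Node reduces_comb_Node reduces_trans by meson
qed

fun full :: "nat \<Rightarrow> tree" where
  "full 0 = Leaf"
| "full (Suc n) = Node (full n) (full n)"

lemma leaves_full [simp]: "leaves (full n) = 2 ^ n"
  by (induction n) auto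

lemma chart_full: "chart (full n) x = 2 ^ n * x"
  by (induction n arbitrary: x) (auto simp: algebra_simps)

text \<open>
  The tree halves the unit interval \<open>L\<close> times, down to the cells of the grid, and then each cell
  \<open>s\<close> more times, where \<open>2\<^sup>s\<close> is the increase of the function on that cell. The induction
  removes the root.
\<close>

lemma chart_exists:
  fixes \<phi> :: "real \<Rightarrow> real"
  assumes "\<phi> 0 = 0"
    and "\<And>j. j < 2 ^ L \<Longrightarrow> \<exists>s::nat. \<forall>y\<in>{0..1}. \<phi> ((real j + y) / 2 ^ L) = \<phi> (real j / 2 ^ L) + 2 ^ s * y"
  shows "\<exists>T. \<forall>x\<in>{0..1}. \<phi> x = chart T x"
  using assms
proof (induction L arbitrary: \<phi>)
  case 0
  from 0(2)[of 0] obtain s :: nat where "\<forall>y\<in>{0..1}. \<phi> y = 2 ^ s * y" using 0(1) by auto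
  then show ?case using chart_full by (metis)
next
  case (Suc L)
  define \<phi>0 where "\<phi>0 x = \<phi> (x / 2)" for x
  define \<phi>1 where "\<phi>1 x = \<phi> ((x + 1) / 2) - \<phi> (1 / 2)" for x
  have "\<exists>T. \<forall>x\<in>{0..1}. \<phi>0 x = chart T x"
  proof (rule Suc.IH)
    show "\<phi>0 0 = 0" using Suc.prems(1) by (simp add: \<phi>0_def)
    fix j :: nat assume "j < 2 ^ L"
    then have "j < 2 ^ Suc L" by simp
    from Suc.prems(2)[OF this] show
      "\<exists>s::nat. \<forall>y\<in>{0..1}. \<phi>0 ((real j + y) / 2 ^ L) = \<phi>0 (real j / 2 ^ L) + 2 ^ s * y"
      by (simp add: \<phi>0_def mult.commute)
  qed
  then obtain l where l: "\<And>x. x \<in> {0..1} \<Longrightarrow> \<phi>0 x = chart l x" by blast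
  have "\<exists>T. \<forall>x\<in>{0..1}. \<phi>1 x = chart T x"
  proof (rule Suc.IH)
    show "\<phi>1 0 = 0" by (simp add: \<phi>1_def)
    fix j :: nat assume "j < 2 ^ L"
    then have j: "j + 2 ^ L < 2 ^ Suc L" by simp
    have eq: "((real j + y) / 2 ^ L + 1) / 2 = (real (j + 2 ^ L) + y) / 2 ^ Suc L" for y
      by (simp add: field_simps)
    have "\<phi>1 ((real j + y) / 2 ^ L) = \<phi> ((real (j + 2 ^ L) + y) / 2 ^ Suc L) - \<phi> (1 / 2)" for y
      by (simp only: \<phi>1_def eq)
    from this this[of 0] Suc.prems(2)[OF j] show
      "\<exists>s::nat. \<forall>y\<in>{0..1}. \<phi>1 ((real j + y) / 2 ^ L) = \<phi>1 (real j / 2 ^ L) + 2 ^ s * y"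
      by (simp only: add_0_right diff_add_eq) simp
  qed
  then obtain r where r: "\<And>x. x \<in> {0..1} \<Longrightarrow> \<phi>1 x = chart r x" by blast
  have half: "\<phi> (1 / 2) = leaves l" using l[of 1] by (simp add: \<phi>0_def)
  have "\<phi> x = chart (Node l r) x" if "x \<in> {0..1}" for x
    using that l[of "2 * x"] r[of "2 * x - 1"] half
    by (cases "2 * x \<le> 1") (simp_all add: \<phi>0_def \<phi>1_def mult.commute)
  then show ?case by blast
qed

lemma common_denominator:
  assumes "finite B" "B \<subseteq> dyadic_rationals"
  shows "\<exists>L. \<forall>b\<in>B. \<exists>i::int. b = of_int i / 2 ^ L"
  using assms
proof (induction rule: finite_induct)
  case (insert b B)
  then obtain L where L: "\<And>b. b \<in> B \<Longrightarrow> \<exists>i::int. b = of_int i / 2 ^ L" by blast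
  obtain m n where b: "b = of_int m / 2 ^ n" using insert.prems unfolding dyadic_rationals_def by blast
  have "\<exists>i::int. c = of_int i / 2 ^ (L + n)" if c: "c \<in> insert b B" for c
  proof (cases "c = b")
    case True
    then show ?thesis using b by (intro exI[of _ "m * 2 ^ L"]) (simp add: power_add)
  next
    case False
    then obtain i :: int where "c = of_int i / 2 ^ L" using L c by blast
    then show ?thesis by (intro exI[of _ "i * 2 ^ n"]) (simp add: power_add)
  qed
  then show ?case by blast
qed simp

text \<open>
  On a fine enough grid \<open>k\<close> is affine on each cell. The slopes may be less than 1, so \<open>k\<close> is multiplied
  by a large power of 2 to make every cell increase by a power of 2 with natural exponent.
\<close>

lemma chart_of_F_on:
  assumes k: "k \<in> F_on 0 1"
  obtains m T where "\<And>x. x \<in> {0..1} \<Longrightarrow> 2 ^ m * k x = chart T x"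
proof -
  obtain B where B: "finite B" "B \<subseteq> dyadic_rationals" "breaks_in B k"
    using F_onE[OF k] .
  obtain L where L: "\<And>b. b \<in> B \<Longrightarrow> \<exists>i::int. b = of_int i / 2 ^ L"
    using common_denominator[OF B(1,2)] by blast
  have "\<exists>s. \<forall>y\<in>{0..1}. k ((real j + y) / 2 ^ L) = k (real j / 2 ^ L) + 2 powi s * (y / 2 ^ L)" for j
  proof -
    have "{real j / 2 ^ L<..<(real j + 1) / 2 ^ L} \<inter> B = {}"
    proof (rule ccontr)
      assume "{real j / 2 ^ L<..<(real j + 1) / 2 ^ L} \<inter> B \<noteq> {}"
      then obtain i :: int where "real j / 2 ^ L < i / 2 ^ L" "i / 2 ^ L < (real j + 1) / 2 ^ L"
        using L by fastforce
      then have "real j < i" "i < real j + 1" by (simp_all add: divide_less_cancel)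
      then have "int j < i" "i < int j + 1" by linarith+
      then show False by simp
    qed
    moreover have "real j / 2 ^ L < (real j + 1) / 2 ^ L" by (simp add: divide_strict_right_mono)
    ultimately obtain s where s: "\<And>x. real j / 2 ^ L \<le> x \<Longrightarrow> x \<le> (real j + 1) / 2 ^ L \<Longrightarrow>
        k x = k (real j / 2 ^ L) + 2 powi s * (x - real j / 2 ^ L)"
      using breaks_inD[OF B(3)] by metis
    have "k ((real j + y) / 2 ^ L) = k (real j / 2 ^ L) + 2 powi s * (y / 2 ^ L)" if "y \<in> {0..1}" for y
      using s[of "(real j + y) / 2 ^ L"] that by (simp add: divide_right_mono diff_divide_distrib[symmetric])
    then show ?thesis by blast
  qed
  then obtain s where s: "\<And>j y. y \<in> {0..1} \<Longrightarrow>
      k ((real j + y) / 2 ^ L) = k (real j / 2 ^ L) + 2 powi s j * (y / 2 ^ L)" by metis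
  define m where "m = L + nat (\<Sum>j<2 ^ L. \<bar>s j\<bar>)"
  have "\<exists>T. \<forall>x\<in>{0..1}. 2 ^ m * k x = chart T x"
  proof (rule chart_exists)
    show "2 ^ m * k 0 = 0" using F_on_fix[OF k, of 0] by simp
    fix j :: nat assume "j < 2 ^ L"
    then have "\<bar>s j\<bar> \<le> (\<Sum>j<2 ^ L. \<bar>s j\<bar>)" by (intro member_le_sum) auto
    \<comment> \<open>The choice of m as a sum bounds every exponent at once.\<close>
    then have nn: "0 \<le> int m - int L + s j" unfolding m_def by linarith
    define t where "t = nat (int m - int L + s j)"
    have "(2::real) ^ m * (2 powi s j * (1 / 2 ^ L)) = 2 powi (int m - int L + s j)"
      by (simp add: power_int_add power_int_diff)
    also have "\<dots> = 2 ^ t" using nn by (simp add: t_def power_int_def)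
    finally have t: "(2::real) ^ m * (2 powi s j * (1 / 2 ^ L)) = 2 ^ t" .
    have "2 ^ m * k ((real j + y) / 2 ^ L) = 2 ^ m * k (real j / 2 ^ L) + 2 ^ t * y" if "y \<in> {0..1}" for y
      unfolding s[OF that] t[symmetric] by (simp add: algebra_simps)
    then show "\<exists>t::nat. \<forall>y\<in>{0..1}. 2 ^ m * k ((real j + y) / 2 ^ L) = 2 ^ m * k (real j / 2 ^ L) + 2 ^ t * y"
      by blast
  qed
  then show ?thesis using that by blast
qed

text \<open>
  If \<open>2\<^sup>m h\<^sup>-\<^sup>1\<close> is the chart of \<open>T\<close>, then \<open>h\<close> is represented by the pair formed by the full tree of
  depth \<open>m\<close>, whose chart is \<open>2\<^sup>m x\<close>, and \<open>T\<close>. Both trees reduce to the same comb.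
\<close>

lemma F_on_subset_tree_group:
  assumes h: "h \<in> F_on 0 1"
  shows "h \<in> tree_group"
proof -
  obtain m T where T: "\<And>x. x \<in> {0..1} \<Longrightarrow> 2 ^ m * finv h x = chart T x"
    using chart_of_F_on[OF F_on_inverse[OF h]] by blast
  have eq: "chart (full m) x = chart T (h x)" if "x \<in> {0..1}" for x
    using T[of "h x"] F_on_maps(2)[OF h that] h by (simp add: chart_full)
  have "leaves (full m) = leaves T" using eq[of 1] F_on_fix[OF h, of 1] by simp
  moreover obtain i j where ij: "reduces (full m) (comb i)" "reduces T (comb j)"
    using reduces_to_comb by meson
  ultimately have "i = j" using reduces_leaves by fastforce
  then obtain f g where f: "f \<in> tree_group" "\<And>x. x \<in> {0..1} \<Longrightarrow> chart (full m) x = chart (comb j) (f x)"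
    and g: "g \<in> tree_group" "\<And>x. x \<in> {0..1} \<Longrightarrow> chart T x = chart (comb j) (g x)"
    using ij unfolding reduces_def by blast
  note fF = tree_group_F_on[OF f(1)] and gF = tree_group_F_on[OF g(1)]
  have "f x = g (h x)" for x
  proof (cases "x \<in> {0..1}")
    case True
    have "h x \<in> {0..1}" using F_on_maps(2)[OF h True] .
    moreover have "chart (comb j) (f x) = chart (comb j) (g (h x))"
      using f(2)[OF True] g(2)[OF \<open>h x \<in> {0..1}\<close>] eq[OF True] by simp
    ultimately show ?thesis
      using chart_inj F_on_maps(2)[OF fF True] F_on_maps(2)[OF gF] by blast
  next
    case False
    then show ?thesis using F_on_fix[OF fF, of x] F_on_fix[OF gF, of x] F_on_fix[OF h, of x] by auto
  qed
  then have "h = finv g \<circ> f" using gF by (simp add: fun_eq_iff)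
  then show ?thesis using tree_group.comp tree_group.inverse f g by simp
qed

definition comp_group :: "(real \<Rightarrow> real) set \<Rightarrow> bool" where
  "comp_group H \<longleftrightarrow> id \<in> H \<and> (\<forall>f\<in>H. bij f \<and> finv f \<in> H) \<and> (\<forall>f\<in>H. \<forall>g\<in>H. f \<circ> g \<in> H)"

lemma comp_groupD:
  assumes "comp_group H"
  shows "id \<in> H" "f \<in> H \<Longrightarrow> bij f" "f \<in> H \<Longrightarrow> finv f \<in> H" "f \<in> H \<Longrightarrow> g \<in> H \<Longrightarrow> f \<circ> g \<in> H"
  using assms unfolding comp_group_def by auto

lemma comp_group_conj_iff:
  assumes H: "comp_group H" and h: "h \<in> H" and eq: "h \<circ> f = g \<circ> h"
  shows "f \<in> H \<longleftrightarrow> g \<in> H"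
proof -
  have 1: "finv h \<circ> h = id" "h \<circ> finv h = id"
    using comp_groupD(2)[OF H h] by (auto simp: fun_eq_iff bij_is_surj surj_f_inv_f bij_is_inj)
  have "f = finv h \<circ> (g \<circ> h)" using 1 by (metis comp_assoc eq comp_id id_comp)
  moreover have "g = (h \<circ> f) \<circ> finv h" using 1 by (metis comp_assoc eq comp_id id_comp)
  ultimately show ?thesis using comp_groupD[OF H] h by metis
qed

lemma rot_conj:
  assumes f: "f \<in> F_on 0 1"
  shows "rot \<circ> lft (lft f) = lft f \<circ> rot"
    and "rot \<circ> lft (rgt f) = rgt (lft f) \<circ> rot"
    and "rot \<circ> rgt f = rgt (rgt f) \<circ> rot"
proof -
  have m: "strict_mono rot" using F_on_strict_mono rot_in_F_on by blast
  have "rot \<circ> rescale 0 (1/4) f = rescale 0 (1/2) f \<circ> rot"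
    by (rule conj_rescale[OF m f]) (auto simp: rot_def)
  then show "rot \<circ> lft (lft f) = lft f \<circ> rot" by (simp add: rescale_rescale)
  have "rot \<circ> rescale (1/4) (1/4) f = rescale (1/2) (1/4) f \<circ> rot"
    by (rule conj_rescale[OF m f]) (auto simp: rot_def)
  then show "rot \<circ> lft (rgt f) = rgt (lft f) \<circ> rot" by (simp add: rescale_rescale)
  have "rot \<circ> rescale (1/2) (1/2) f = rescale (3/4) (1/4) f \<circ> rot"
    by (rule conj_rescale[OF m f]) (auto simp: rot_def)
  then show "rot \<circ> rgt f = rgt (rgt f) \<circ> rot" by (simp add: rescale_rescale)
qed

text \<open>
  The two ways from \<open>((A B) C) D\<close> to \<open>A (B (C D))\<close> by rotations.
\<close>

lemma rot_pentagon: "rot \<circ> rot = rgt rot \<circ> rot \<circ> lft rot"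
  by (auto simp: fun_eq_iff rot_def rescale_def field_simps)

text \<open>
  The copy of \<open>f\<close> on the dyadic interval reached from the root by following the word, with
  \<open>True\<close> for the right half.
\<close>

fun node :: "bool list \<Rightarrow> (real \<Rightarrow> real) \<Rightarrow> real \<Rightarrow> real" where
  "node [] f = f"
| "node (b # v) f = (if b then rgt (node v f) else lft (node v f))"

lemma node_F_on: "f \<in> F_on 0 1 \<Longrightarrow> node v f \<in> F_on 0 1"
  by (induction v) (auto simp: lft_rgt_unit)

lemma node_append: "node (v @ w) f = node v (node w f)"
  by (induction v) auto

lemma node_comp: "node v (f \<circ> g) = node v f \<circ> node v g"
  by (induction v) (simp_all add: rescale_comp[unfolded comp_def] comp_def)

lemma node_id: "node v id = id"
  by (induction v) (simp_all add: rescale_id[unfolded id_def] id_def)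

lemma node_finv: "f \<in> F_on 0 1 \<Longrightarrow> node v (finv f) = finv (node v f)"
  by (induction v) (auto simp: rescale_inv F_on_bij[OF node_F_on])

text \<open>
  The pentagon relation expresses the rotation at a left child by the rotations at its parent and its
  sibling, so the rotations at all nodes of depth at most 1, and at the node right-left, are available.
  Conjugation by \<open>rot\<close> and by \<open>lft rot\<close> identifies the rotation at any deeper node with that at a
  shorter or already treated one.
\<close>

lemma node_rot_in_comp_group:
  assumes H: "comp_group H" and r: "rot \<in> H" "rgt rot \<in> H"
  shows "node v rot \<in> H"
proof -
  note G = comp_groupD[OF H]
  have rot_finv: "rot \<circ> finv rot = id" "finv rot \<circ> rot = id"
    using F_on_inv(3,4)[OF rot_in_F_on] by auto
  have lr: "lft rot \<in> H"
  proof -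
    have "lft rot = finv rot \<circ> (finv (rgt rot) \<circ> (rot \<circ> rot))"
      unfolding rot_pentagon using F_on_inv(2)[OF rot_in_F_on]
        F_on_inv(2)[OF lft_rgt_unit(2)[OF rot_in_F_on]] by (simp add: fun_eq_iff)
    then show ?thesis using G r by metis
  qed
  have rr: "rgt (rgt rot) \<in> H"
    using comp_group_conj_iff[OF H r(1) rot_conj(3)[OF rot_in_F_on]] r by simp
  have rlr: "rgt (lft rot) \<in> H"
  proof -
    have "rgt rot \<circ> rgt rot = rgt (rgt rot) \<circ> rgt rot \<circ> rgt (lft rot)"
      using arg_cong[OF rot_pentagon, of rgt] by (simp add: rescale_comp)
    then have "rgt (lft rot) = finv (rgt rot) \<circ> (finv (rgt (rgt rot)) \<circ> (rgt rot \<circ> rgt rot))"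
      using F_on_inv(2)[OF lft_rgt_unit(2)[OF rot_in_F_on]]
        F_on_inv(2)[OF lft_rgt_unit(2)[OF lft_rgt_unit(2)[OF rot_in_F_on]]] by (simp add: fun_eq_iff)
    then show ?thesis using G r rr by metis
  qed
  note nF = node_F_on[OF rot_in_F_on]
  have LL: "node (False # False # w) rot \<in> H \<longleftrightarrow> node (False # w) rot \<in> H" for w
    using comp_group_conj_iff[OF H r(1) rot_conj(1)[OF nF]] by simp
  have LR: "node (False # True # w) rot \<in> H \<longleftrightarrow> node (True # False # w) rot \<in> H" for w
    using comp_group_conj_iff[OF H r(1) rot_conj(2)[OF nF]] by simp
  have RR: "node (True # True # w) rot \<in> H \<longleftrightarrow> node (True # w) rot \<in> H" for w
    using comp_group_conj_iff[OF H r(1) rot_conj(3)[OF nF]] by simp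
  have LLR: "node (False # False # True # w) rot \<in> H \<longleftrightarrow> node (False # True # False # w) rot \<in> H" for w
    using comp_group_conj_iff[OF H lr arg_cong[OF rot_conj(2)[OF nF], of lft, unfolded rescale_comp[of "1/2", simplified]]]
    by simp
  have LRR: "node (False # True # w) rot \<in> H \<longleftrightarrow> node (False # True # True # w) rot \<in> H" for w
    using comp_group_conj_iff[OF H lr arg_cong[OF rot_conj(3)[OF nF], of lft, unfolded rescale_comp[of "1/2", simplified]]]
    by simp
  have LRv: "node (False # True # v) rot \<in> H" for v
  proof (induction v)
    case Nil
    then show ?case using LR[of "[]"] rlr by simp
  next
    case (Cons b v)
    then show ?case using LRR[of v] LLR[of v] LL[of "True # v"] by (cases b) (simp_all del: node.simps)
  qed
  show ?thesis
  proof (induction v)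
    case (Cons b v)
    show ?case
    proof (cases v)
      case Nil then show ?thesis using r lr by simp
    next
      case (Cons d w)
      then show ?thesis using \<open>node v rot \<in> H\<close> LL[of w] RR[of w] LR[of w] LRv[of w]
        by (cases b; cases d) (simp_all del: node.simps)
    qed
  qed (simp add: r)
qed

text \<open>
  The elements of Thompson's group arise from \<open>rot\<close> by composition, inversion and passage to the two
  halves. An arbitrary \<open>H\<close> is not closed under the last operation; so the induction proves membership
  for the copies at all nodes at once.
\<close>

theorem two_generators:
  assumes H: "comp_group H" and r: "rot \<in> H" "rgt rot \<in> H" and h: "h \<in> F_on 0 1"
  shows "h \<in> H"
proof -
  note G = comp_groupD[OF H]
  have "\<forall>v. node v h \<in> H" if "h \<in> tree_group" for h
    using that
  proof (induction rule: tree_group.induct)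
    case rot then show ?case using node_rot_in_comp_group[OF H r] by simp
  next
    case id then show ?case using G(1) node_id by (simp add: id_def)
  next
    case (comp f g) then show ?case using G(4) node_comp[of _ f g] by (simp add: comp_def)
  next
    case (inverse f) then show ?case using G(3) node_finv[OF tree_group_F_on] by simp
  next
    case (lft f)
    then have "node (v @ [False]) f \<in> H" for v by blast
    then show ?case by (simp add: node_append)
  next
    case (rgt f)
    then have "node (v @ [True]) f \<in> H" for v by blast
    then show ?case by (simp add: node_append)
  qed
  from this[OF F_on_subset_tree_group[OF h]] have "node [] h \<in> H" by blast
  then show ?thesis by simp
qed

section \<open>Commutators, germs at the end points, and orbits\<close>

definition commutator :: "(real \<Rightarrow> real) \<Rightarrow> (real \<Rightarrow> real) \<Rightarrow> real \<Rightarrow> real" where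
  "commutator f g = f \<circ> g \<circ> finv f \<circ> finv g"

lemma rescale_commutator: "bij f \<Longrightarrow> bij g \<Longrightarrow> l \<noteq> 0 \<Longrightarrow> rescale p l (commutator f g) = commutator (rescale p l f) (rescale p l g)"
  by (simp only: commutator_def rescale_comp rescale_inv not_False_eq_True)

lemma commutator_in_F_on: "f \<in> F_on a b \<Longrightarrow> g \<in> F_on a b \<Longrightarrow> commutator f g \<in> F_on a b"
  unfolding commutator_def by (intro F_on_comp F_on_inverse)

lemma commutator_apply: "f \<in> F_on a b \<Longrightarrow> g \<in> F_on c d \<Longrightarrow> commutator f g (g (f x)) = f (g x)"
  by (simp add: commutator_def)

text \<open>
  Evaluating at \<open>g (f x)\<close> instead of \<open>x\<close> avoids the inverses in the commutator.
\<close>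

lemma commutator_eqI:
  assumes "f \<in> F_on a b" "g \<in> F_on c d" "\<And>x. h (g (f x)) = f (g x)"
  shows "h = commutator f g"
proof
  fix y
  show "h y = commutator f g y" using assms(3)[of "finv f (finv g y)"] assms(1,2) by (simp add: commutator_def)
qed

text \<open>
  With \<open>(e, s) = (0, 1)\<close> this says that the slope of \<open>f\<close> at \<open>0\<^sup>+\<close> is \<open>2\<^sup>k\<close>, and with
  \<open>(e, s) = (1, -1)\<close> that the slope at \<open>1\<^sup>-\<close> is \<open>2\<^sup>k\<close>; in both cases \<open>e\<close> is fixed. The two ends are
  treated by the same lemmas.
\<close>

definition germ :: "real \<Rightarrow> real \<Rightarrow> (real \<Rightarrow> real) \<Rightarrow> int \<Rightarrow> bool" where
  "germ e s f k \<longleftrightarrow> (\<exists>d>0. \<forall>x. 0 \<le> x \<and> x \<le> d \<longrightarrow> f (e + s * x) = e + s * (2 powi k * x))"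

lemma germ_comp:
  assumes "germ e s f k" "germ e s g m" shows "germ e s (g \<circ> f) (m + k)"
proof -
  obtain c where c: "c > 0" "\<And>x. 0 \<le> x \<Longrightarrow> x \<le> c \<Longrightarrow> f (e + s * x) = e + s * (2 powi k * x)"
    using assms(1) unfolding germ_def by blast
  obtain d where d: "d > 0" "\<And>x. 0 \<le> x \<Longrightarrow> x \<le> d \<Longrightarrow> g (e + s * x) = e + s * (2 powi m * x)"
    using assms(2) unfolding germ_def by blast
  have "(g \<circ> f) (e + s * x) = e + s * (2 powi (m + k) * x)"
    if "0 \<le> x" "x \<le> min c (2 powi (- k) * d)" for x
  proof -
    have "2 powi k * x \<le> d" using that by (simp add: power_int_minus field_simps)
    then show ?thesis using c(2)[of x] d(2)[of "2 powi k * x"] that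
      by (simp add: power_int_add)
  qed
  moreover have "min c (2 powi (- k) * d) > 0" using c d by simp
  ultimately show ?thesis unfolding germ_def by blast
qed

lemma germ_inv:
  assumes "germ e s f k" "bij f" shows "germ e s (finv f) (- k)"
proof -
  obtain c where c: "c > 0" "\<And>x. 0 \<le> x \<Longrightarrow> x \<le> c \<Longrightarrow> f (e + s * x) = e + s * (2 powi k * x)"
    using assms(1) unfolding germ_def by blast
  have "finv f (e + s * x) = e + s * (2 powi (- k) * x)"
    if "0 \<le> x" "x \<le> 2 powi k * c" for x
  proof -
    have "2 powi (- k) * x \<le> c" using that by (simp add: power_int_minus field_simps)
    then have "f (e + s * (2 powi (- k) * x)) = e + s * x"
      using c(2)[of "2 powi (- k) * x"] that by (simp add: power_int_minus)
    then show ?thesis using assms(2) by (metis bij_inv_eq_iff)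
  qed
  moreover have "2 powi k * c > 0" using c by simp
  ultimately show ?thesis unfolding germ_def by blast
qed

lemma germ_ends:
  assumes f: "f \<in> F_on 0 1"
  shows "\<exists>k. germ 0 1 f k" "\<exists>k. germ 1 (- 1) f k"
proof -
  obtain B where B: "finite B" "B \<subseteq> dyadic_rationals" "breaks_in B f"
    using F_onE[OF f] .
  have f01: "f 0 = 0" "f 1 = 1" using F_on_fix[OF f] by auto
  obtain d where d: "d > 0" "\<And>x. x \<in> B \<Longrightarrow> x \<noteq> 0 \<Longrightarrow> d \<le> dist 0 x"
    using finite_set_avoid[OF B(1), of 0] by blast
  have "{0<..<d} \<inter> B = {}" using d(2) by (force simp: dist_real_def)
  from breaks_inD[OF B(3) d(1) this] obtain k where
    "\<And>x. 0 \<le> x \<Longrightarrow> x \<le> d \<Longrightarrow> f x = f 0 + 2 powi k * (x - 0)" by blast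
  then show "\<exists>k. germ 0 1 f k" unfolding germ_def using d(1) f01 by auto
  obtain d where d: "d > 0" "\<And>x. x \<in> B \<Longrightarrow> x \<noteq> 1 \<Longrightarrow> d \<le> dist 1 x"
    using finite_set_avoid[OF B(1), of 1] by blast
  have "{1 - d<..<1} \<inter> B = {}" using d(2) by (force simp: dist_real_def)
  from breaks_inD[OF B(3) _ this] d(1) obtain k where
    k: "\<And>x. 1 - d \<le> x \<Longrightarrow> x \<le> 1 \<Longrightarrow> f x = f (1 - d) + 2 powi k * (x - (1 - d))" by auto
  have "f (1 - x) = 1 - 2 powi k * x" if "0 \<le> x" "x \<le> d" for x
    using k[of 1] k[of "1 - x"] that d(1) f01 by (simp add: algebra_simps)
  then show "\<exists>k. germ 1 (- 1) f k" unfolding germ_def using d(1) by auto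
qed

text \<open>
  Compact support in the open unit interval; enlarging the support allows a single margin for both
  ends.
\<close>

definition F_cpt :: "(real \<Rightarrow> real) set" where
  "F_cpt = {f. \<exists>d>0. d < 1/2 \<and> f \<in> F_on d (1 - d)}"

lemma F_cpt_unit: "f \<in> F_cpt \<Longrightarrow> f \<in> F_on 0 1"
  unfolding F_cpt_def by (auto intro: F_on_mono)

lemma F_on_F_cpt: "f \<in> F_on a b \<Longrightarrow> 0 < a \<Longrightarrow> b < 1 \<Longrightarrow> f \<in> F_cpt"
  unfolding F_cpt_def
  by (rule CollectI, rule exI[of _ "min (1/3) (min a (1 - b))"])
     (auto simp: min_def intro: F_on_mono)

lemma F_cpt_shrink:
  assumes "f \<in> F_cpt" "g \<in> F_cpt" "0 < e"
  obtains d where "0 < d" "d < 1/2" "d \<le> e" "f \<in> F_on d (1 - d)" "g \<in> F_on d (1 - d)"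
proof -
  obtain c where c: "c > 0" "c < 1/2" "f \<in> F_on c (1 - c)" using assms unfolding F_cpt_def by blast
  obtain d where d: "d > 0" "d < 1/2" "g \<in> F_on d (1 - d)" using assms unfolding F_cpt_def by blast
  show ?thesis
    by (rule that[of "min e (min c d)"]) (use c d assms(3) in \<open>auto intro: F_on_mono\<close>)
qed

lemma F_cpt_comp: "f \<in> F_cpt \<Longrightarrow> g \<in> F_cpt \<Longrightarrow> f \<circ> g \<in> F_cpt"
  using F_cpt_shrink[of f g 1] F_on_comp unfolding F_cpt_def by (metis (mono_tags, lifting) mem_Collect_eq zero_less_one)

lemma germ_zero_F_cpt:
  assumes f: "f \<in> F_on 0 1" and g: "germ 0 1 f 0" "germ 1 (- 1) f 0"
  shows "f \<in> F_cpt"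
proof -
  obtain c where c: "c > 0" "\<And>x. 0 \<le> x \<Longrightarrow> x \<le> c \<Longrightarrow> f x = x"
    using g(1) unfolding germ_def by auto
  obtain d where d: "d > 0" "\<And>x. 0 \<le> x \<Longrightarrow> x \<le> d \<Longrightarrow> f (1 - x) = 1 - x"
    using g(2) unfolding germ_def by auto
  define m where "m = min (1/3) (min c d)"
  have "f x = x" if "x \<notin> {m<..<1 - m}" for x
    using c(2)[of x] d(2)[of "1 - x"] F_on_fix[OF f, of x] that unfolding m_def
    by (cases "0 < x \<and> x < 1") auto
  then have "f \<in> F_on m (1 - m)" using f unfolding F_on_def by blast
  moreover have "0 < m" "m < 1/2" using c d unfolding m_def by auto
  ultimately show ?thesis unfolding F_cpt_def by blast
qed

text \<open>
  Germs at the end points commute, so a commutator has slope 1 at both ends.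
\<close>

lemma commutator_F_cpt:
  assumes f: "f \<in> F_on 0 1" and g: "g \<in> F_on 0 1"
  shows "commutator f g \<in> F_cpt"
proof (rule germ_zero_F_cpt)
  show "commutator f g \<in> F_on 0 1" using f g by (rule commutator_in_F_on)
  have *: "germ e s (commutator f g) 0" if "germ e s f k" "germ e s g m" for e s k m
    using germ_comp[OF germ_comp[OF germ_comp[OF germ_inv[OF that(2) F_on_bij[OF g]]
          germ_inv[OF that(1) F_on_bij[OF f]]] that(2)] that(1)]
    by (simp add: commutator_def comp_assoc)
  show "germ 0 1 (commutator f g) 0" "germ 1 (- 1) (commutator f g) 0"
    using germ_ends[OF f] germ_ends[OF g] * by blast+
qed

text \<open>
  Otherwise the infimum of the orbit would lie in \<open>[b, x]\<close>; as the infimum of an orbit of increasing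
  bijections it would be a common fixed point.
\<close>

lemma orbit_below:
  fixes x b :: real
  assumes H: "comp_group H" and mono: "\<And>h. h \<in> H \<Longrightarrow> strict_mono h"
    and moves: "\<And>z. b \<le> z \<Longrightarrow> z \<le> x \<Longrightarrow> \<exists>h\<in>H. h z \<noteq> z"
  shows "\<exists>h\<in>H. h x < b"
proof (rule ccontr)
  assume "\<not> (\<exists>h\<in>H. h x < b)"
  then have lb: "\<And>h. h \<in> H \<Longrightarrow> b \<le> h x" by force
  note G = comp_groupD[OF H]
  define m where "m = (INF h\<in>H. h x)"
  have bdd: "bdd_below ((\<lambda>h. h x) ` H)" using lb by (intro bdd_belowI[of _ b]) auto
  have le: "m \<le> h x" if "h \<in> H" for h unfolding m_def using cINF_lower[OF bdd that] .
  have "m \<le> x" using le[OF G(1)] by simp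
  moreover have "b \<le> m" unfolding m_def using lb G(1) by (intro cINF_greatest) auto
  ultimately obtain h where h: "h \<in> H" "h m \<noteq> m" using moves by blast
  have inv: "h (finv h y) = y" "finv h (h y) = y" for y
    using G(2)[OF h(1)] by (auto simp: bij_is_surj surj_f_inv_f bij_is_inj)
  obtain t where t: "t \<in> H" "m < t m"
  proof (cases "m < h m")
    case False
    then have "finv h (h m) < finv h m" using mono[OF G(3)[OF h(1)]] h(2)
      by (simp add: strict_mono_less)
    then show ?thesis using that[of "finv h"] inv G(3)[OF h(1)] by simp
  qed (use that h in blast)
  have inv: "t (finv t y) = y" for y
    using G(2)[OF t(1)] by (auto simp: bij_is_surj surj_f_inv_f)
  have "\<exists>y\<in>(\<lambda>h. h x) ` H. y < t m"
    using t(2) G(1) bdd unfolding m_def by (intro cInf_lessD) auto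
  then obtain k where k: "k \<in> H" "k x < t m" by blast
  then have "t (finv t (k x)) < t m" using inv by simp
  then have "finv t (k x) < m" using mono[OF t(1)] by (simp add: strict_mono_less)
  moreover have "m \<le> (finv t \<circ> k) x" using le G(3)[OF t(1)] G(4) k(1) by blast
  ultimately show False by simp
qed

lemma orbit_above:
  fixes x b :: real
  assumes H: "comp_group H" and mono: "\<And>h. h \<in> H \<Longrightarrow> strict_mono h"
    and moves: "\<And>z. x \<le> z \<Longrightarrow> z \<le> b \<Longrightarrow> \<exists>h\<in>H. h z \<noteq> z"
  shows "\<exists>h\<in>H. b < h x"
proof -
  obtain h where h: "h \<in> H" "h b < x" using orbit_below[OF H mono moves] by blast
  have "finv h (h b) = b" using comp_groupD(2)[OF H h(1)] by (simp add: bij_is_inj)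
  then have "b < finv h x" using mono[OF comp_groupD(3)[OF H h(1)]] h(2) strict_mono_less by metis
  then show ?thesis using comp_groupD(3)[OF H h(1)] by blast
qed

text \<open>
  Moving \<open>y\<close> below \<open>b\<close> may push \<open>x\<close> far to the left. The elements that fix \<open>b\<close> keep the image
  of \<open>y\<close> below \<open>b\<close> while they bring the image of \<open>x\<close> back above \<open>a\<close>.
\<close>

lemma compress:
  assumes H: "comp_group H" and sub: "H \<subseteq> F_on 0 1" and ab: "0 < a" "a < b" "b < 1"
    and moves: "\<And>z. 0 < z \<Longrightarrow> z < 1 \<Longrightarrow> \<exists>h\<in>H. h z \<noteq> z"
    and stab: "\<And>z. 0 < z \<Longrightarrow> z \<le> a \<Longrightarrow> \<exists>h\<in>H. h b = b \<and> h z \<noteq> z"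
    and xy: "0 < x" "x < y" "y < 1"
  shows "\<exists>t\<in>H. a < t x \<and> t y < b"
proof -
  note G = comp_groupD[OF H]
  have mono: "\<And>h. h \<in> H \<Longrightarrow> strict_mono h" using sub F_on_strict_mono by blast
  have "\<exists>t\<in>H. t y < b"
  proof (cases "y < b")
    case True then show ?thesis using G(1) by (intro bexI[of _ id]) auto
  next
    case False
    show ?thesis by (rule orbit_below[OF H mono]) (use moves ab xy in auto)
  qed
  then obtain t where t: "t \<in> H" "t y < b" by blast
  have tx: "0 < t x" "t x < t y"
    using F_on_maps(1)[of t 0 1 x] F_on_less[of t 0 1] t(1) sub xy by auto
  define S where "S = {h \<in> H. h b = b}"
  have S: "comp_group S" unfolding comp_group_def S_def
    using G by (auto simp: bij_is_inj) (metis bij_is_inj inv_f_f)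
  have "\<exists>s\<in>S. a < s (t x)"
  proof (rule orbit_above[OF S])
    fix z assume "t x \<le> z" "z \<le> a"
    then show "\<exists>h\<in>S. h z \<noteq> z" using stab[of z] tx by (auto simp: S_def)
  qed (use mono in \<open>auto simp: S_def\<close>)
  then obtain s where s: "s \<in> S" "a < s (t x)" by blast
  have "s (t y) < s b" using strict_monoD[OF mono, of s "t y" b] s t by (simp add: S_def)
  then show ?thesis using s t G(4)[of s t] by (intro bexI[of _ "s \<circ> t"]) (auto simp: S_def)
qed

text \<open>
  On \<open>[p, q]\<close> the pairs \<open>(k1, k2)\<close> and \<open>(u, v)\<close> agree; on the rest of \<open>[p1, q1]\<close> only \<open>k1\<close> can move
  points, and outside \<open>[p1, q1]\<close> only \<open>k2\<close> can. So the two functions commute off \<open>[p, q]\<close>, and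
  whatever \<open>k2\<close> does beyond \<open>[p1, q1]\<close> cancels from the commutator.
\<close>

lemma commutator_local:
  assumes u: "u \<in> F_on p q" and v: "v \<in> F_on p q"
    and k1: "k1 \<in> F_on p1 q1" "p1 \<le> p" "p \<le> q" "q \<le> q1" "\<And>x. x \<in> {p..q} \<Longrightarrow> k1 x = u x"
    and k2: "k2 \<in> F_on a b" "\<And>x. x \<in> {p1..q1} \<Longrightarrow> k2 x = v x"
  shows "commutator k1 k2 = commutator u v"
proof (rule commutator_eqI[OF k1(1) k2(1), symmetric])
  fix x
  have fp: "u p = p" "u q = q" "v p = p" "v q = q" "v p1 = p1" "v q1 = q1" "k1 p1 = p1" "k1 q1 = q1"
    using F_on_fix[OF u] F_on_fix[OF v] F_on_fix[OF k1(1)] k1 by auto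
  have fix_c: "commutator u v z = z" if "z \<notin> {p<..<q}" for z
    using F_on_fix[OF commutator_in_F_on[OF u v] that] .
  consider (inside) "x \<in> {p..q}" | (mid) "x \<in> {p1..q1}" "x \<notin> {p..q}" | (out) "x \<notin> {p1..q1}" by blast
  then show "commutator u v (k2 (k1 x)) = k1 (k2 x)"
  proof cases
    case inside
    have 1: "u x \<in> {p..q}" "v x \<in> {p..q}" using F_on_maps(2)[OF u inside] F_on_maps(2)[OF v inside] .
    have "k2 (k1 x) = v (u x)" using k1(5)[OF inside] k2(2)[of "u x"] 1 k1 by auto
    moreover have "k1 (k2 x) = u (v x)" using k1(5)[of "v x"] k2(2)[of x] 1 k1 inside by auto
    ultimately show ?thesis using commutator_apply[OF u v] by simp
  next
    case mid
    then have "k1 x \<in> {p1..q1}" using F_on_maps(2)[OF k1(1)] by blast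
    moreover have "k1 x \<notin> {p..q}"
    proof -
      have "k1 p = p" "k1 q = q" using k1 fp by auto
      then show ?thesis using mid(2) F_on_less[OF k1(1), of x p] F_on_less[OF k1(1), of q x] by auto
    qed
    ultimately have "k2 (k1 x) = k1 x" "k1 x \<notin> {p<..<q}" using k2(2)[of "k1 x"] F_on_fix[OF v, of "k1 x"] by auto
    moreover have "k2 x = x" using k2(2)[of x] mid F_on_fix[OF v, of x] by auto
    ultimately show ?thesis using fix_c by simp
  next
    case out
    then have "k1 x = x" using F_on_fix[OF k1(1), of x] by auto
    moreover have "k2 x \<notin> {p1..q1}"
    proof -
      have "k2 p1 = p1" "k2 q1 = q1" using k1 k2(2) fp by auto
      then show ?thesis using out F_on_less[OF k2(1), of x p1] F_on_less[OF k2(1), of q1 x] by auto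
    qed
    moreover from this have "k1 (k2 x) = k2 x" using F_on_fix[OF k1(1), of "k2 x"] by auto
    ultimately show ?thesis using fix_c[of "k2 x"] k1 by auto
  qed
qed

text \<open>
  Conjugation by \<open>Z\<^sup>-\<^sup>1\<close> and by \<open>W\<close> carries \<open>rot\<close> to \<open>lft rot\<close> and \<open>rgt rot\<close>, because \<open>Z\<close>
  is \<open>x \<mapsto> 2 x\<close> on \<open>[0, 1/2]\<close> and \<open>W\<close> is \<open>x \<mapsto> (x + 1) / 2\<close> on \<open>[0, 1]\<close>. In the abelianisation the pentagon
  relation then reads \<open>2 x = 3 x\<close>; the formula is the resulting explicit expression of
  \<open>rot\<close> by commutators. In both of them \<open>rot\<close> is the first entry, which permits the second use
  in the proof that small copies of \<open>rot\<close> lie in \<open>H\<close>.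
\<close>

lemma rot_commutators:
  defines "Z \<equiv> rescale 0 2 rot" and "W \<equiv> rescale (- 1) 2 rot"
  shows "rot = commutator rot (finv Z) \<circ> commutator rot (finv rot \<circ> finv rot \<circ> W \<circ> rot \<circ> rot)"
proof -
  have F: "Z \<in> F_on (- 2) 3" "W \<in> F_on (- 2) 3" "rot \<in> F_on (- 2) 3"
    using rescale_in_F_on[OF rot_in_F_on, of 0 2] rescale_in_F_on[OF rot_in_F_on, of "- 1" 2] rot_in_F_on
      dyadic_of_int[of "- 1"]
    unfolding Z_def W_def by (auto intro: F_on_mono)
  have "Z \<circ> rescale 0 (1/2) rot = rescale 0 1 rot \<circ> Z"
    by (rule conj_rescale[OF F_on_strict_mono[OF F(1)] rot_in_F_on]) (auto simp: Z_def rescale_def rot_def)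
  then have l: "lft rot x = finv Z (rot (Z x))" for x
    using F_on_inv(2)[OF F(1)] by (simp add: fun_eq_iff) metis
  have "W \<circ> rescale 0 1 rot = rescale (1/2) (1/2) rot \<circ> W"
    by (rule conj_rescale[OF F_on_strict_mono[OF F(2)] rot_in_F_on])
       (auto simp: W_def rescale_def rot_def field_simps)
  then have r: "rgt rot x = W (rot (finv W x))" for x
    using F_on_inv(1)[OF F(2)] by (simp add: fun_eq_iff)
  have pent: "rot (rot x) = W (rot (finv W (rot (finv Z (rot (Z x))))))" for x
    using fun_cong[OF rot_pentagon, of x] by (simp add: l r)
  \<comment> \<open>The conjugate by the square of rot turns a product of a commutator and a conjugated commutator
    into a product of two commutators with first entry rot.\<close>
  define V where "V = finv rot \<circ> finv rot \<circ> W \<circ> rot \<circ> rot"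
  have V: "V \<in> F_on (- 2) 3" unfolding V_def using F F_on_comp F_on_inverse by metis
  have V_apply: "V x = finv rot (finv rot (W (rot (rot x))))" for x by (simp add: V_def)
  have finvV: "finv V = finv rot \<circ> finv rot \<circ> finv W \<circ> rot \<circ> rot"
    unfolding V_def by (rule inv_unique_comp) (simp_all add: fun_eq_iff F_on_inv[OF F(2)] F_on_inv[OF F(3)])
  have "finv (finv Z) = Z" using F_on_bij[OF F(1)] by (simp add: inv_inv_eq)
  then have "(commutator rot (finv Z) \<circ> commutator rot V) x = rot x" for x
    using F by (simp add: commutator_def finvV V_apply, simp add: pent)
  then show ?thesis unfolding V_def by (simp add: fun_eq_iff)
qed

section \<open>From generation on one interval to all compactly supported elements\<close>

text \<open>
  The hypotheses on \<open>H\<close> that the construction of the second generator provides. Those named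
  \<open>moves\<close> and \<open>stab\<close> are the hypotheses of compression; \<open>gen_rot\<close> and \<open>gen_rgt\<close> say that, on the
  interval \<open>I = [a, a + l]\<close>, elements of \<open>H\<close> restrict to the two generators. The length is a power of 2
  so that rescaling \<open>I\<close> to the unit interval preserves dyadic breaks, and the margins in \<open>bounds\<close>
  leave room for the conjugators of the pentagon argument, which are supported on three times the
  length.
\<close>

locale local_generation =
  fixes H :: "(real \<Rightarrow> real) set" and a l :: real and n :: nat
  assumes H: "comp_group H" and sub: "H \<subseteq> F_on 0 1"
    and l: "l = 1 / 2 ^ n" and a: "a \<in> dyadic_rationals" and bounds: "0 < a - l" "a + 2 * l < 1"
    and moves: "\<And>z. 0 < z \<Longrightarrow> z < 1 \<Longrightarrow> \<exists>h\<in>H. h z \<noteq> z"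
    and stab: "\<And>z. 0 < z \<Longrightarrow> z \<le> a \<Longrightarrow> \<exists>h\<in>H. h (a + l) = a + l \<and> h z \<noteq> z"
    and gen_rot: "\<exists>k\<in>H. \<forall>z\<in>{a..a + l}. k z = rescale a l rot z"
    and gen_rgt: "\<exists>k\<in>H. \<forall>z\<in>{a..a + l}. k z = rescale a l (rgt rot) z"
begin

lemmas G = comp_groupD[OF H]

lemma l_pos: "0 < l" by (simp add: l)

lemma l_dyadic: "l \<in> dyadic_rationals" "1 / l \<in> dyadic_rationals"
proof -
  have "l = 2 powi (- int n)" "1 / l = 2 powi int n" by (simp_all add: l power_int_minus field_simps)
  then show "l \<in> dyadic_rationals" "1 / l \<in> dyadic_rationals" by (metis dyadic_powi)+
qed

lemma rescale_F_on: "f \<in> F_on 0 1 \<Longrightarrow> rescale a l f \<in> F_on a (a + l)"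
  using rescale_in_F_on[of f 0 1 a l] a l_dyadic l_pos by simp

lemma F_on_rescale:
  assumes "h \<in> F_on a (a + l)"
  shows "\<exists>f\<in>F_on 0 1. h = rescale a l f"
proof
  have "- a / l = - (a * (1 / l))" by simp
  then have "- a / l \<in> dyadic_rationals"
    using dyadic_mult[OF a l_dyadic(2)] dyadic_diff[of 0] by simp
  then have "rescale (- a / l) (1 / l) h \<in> F_on (- a / l + 1 / l * a) (- a / l + 1 / l * (a + l))"
    using l_dyadic l_pos by (intro rescale_in_F_on[OF assms]) auto
  then show "rescale (- a / l) (1 / l) h \<in> F_on 0 1" using l_pos by (simp add: field_simps)
  show "h = rescale a l (rescale (- a / l) (1 / l) h)" using l_pos by (simp add: rescale_rescale)
qed

lemma realise_on_I:
  assumes f: "f \<in> F_on 0 1"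
  shows "\<exists>k\<in>H. \<forall>z\<in>{a..a + l}. k z = rescale a l f z"
proof -
  define R where "R = {f \<in> F_on 0 1. \<exists>k\<in>H. \<forall>z\<in>{a..a + l}. k z = rescale a l f z}"
  have "comp_group R"
    unfolding comp_group_def
  proof (intro conjI ballI)
    show "id \<in> R" unfolding R_def using G(1) l_pos by (auto intro!: bexI[of _ id])
  next
    fix f assume "f \<in> R"
    then obtain k where f: "f \<in> F_on 0 1" and k: "k \<in> H" "\<And>z. z \<in> {a..a + l} \<Longrightarrow> k z = rescale a l f z"
      unfolding R_def by blast
    show bij: "bij f" using F_on_bij f by blast
    have "finv k z = rescale a l (finv f) z" if z: "z \<in> {a..a + l}" for z
    proof -
      have "rescale a l (finv f) z \<in> {a..a + l}"
        using F_on_maps(2)[OF rescale_F_on[OF F_on_inverse[OF f]] z] .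
      then have "k (rescale a l (finv f) z) = rescale a l f (rescale a l (finv f) z)" using k(2) by blast
      also have "\<dots> = z" using fun_cong[OF rescale_rescale_finv(1)[OF bij, of l a], of z] l_pos by simp
      finally show ?thesis by (rule inv_f_eq[OF bij_is_inj[OF G(2)[OF k(1)]]])
    qed
    then show "finv f \<in> R" unfolding R_def using f F_on_inverse G(3)[OF k(1)] by blast
  next
    fix f g assume "f \<in> R" "g \<in> R"
    then obtain k m where f: "f \<in> F_on 0 1" "g \<in> F_on 0 1"
      and k: "k \<in> H" "\<And>z. z \<in> {a..a + l} \<Longrightarrow> k z = rescale a l f z"
      and m: "m \<in> H" "\<And>z. z \<in> {a..a + l} \<Longrightarrow> m z = rescale a l g z"
      unfolding R_def by blast
    have "(k \<circ> m) z = rescale a l (f \<circ> g) z" if z: "z \<in> {a..a + l}" for z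
      using k(2)[of "m z"] m(2)[OF z] F_on_maps(2)[OF rescale_F_on[OF f(2)] z] l_pos rescale_comp[of l a f g]
      by simp
    then show "f \<circ> g \<in> R" unfolding R_def using F_on_comp f G(4) k(1) m(1) by blast
  qed
  then have "f \<in> R"
    by (rule two_generators) (use gen_rot gen_rgt f rot_in_F_on lft_rgt_unit in \<open>auto simp: R_def\<close>)
  then show ?thesis unfolding R_def by blast
qed

lemma compress_to_I: "0 < x \<Longrightarrow> x < y \<Longrightarrow> y < 1 \<Longrightarrow> \<exists>t\<in>H. a < t x \<and> t y < a + l"
  using compress[OF H sub, of a "a + l"] moves stab bounds l_pos by auto

text \<open>
  Compressing an interval that carries \<open>u\<close> conjugates \<open>u\<close> to an element supported in \<open>I\<close>, that is, to
  a copy on \<open>I\<close> of an element of Thompson's group.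
\<close>

lemma F_cpt_conj_I:
  assumes u: "u \<in> F_on d (1 - d)" and d: "0 < d" "d < 1/2"
  obtains t f where "t \<in> H" "a < t d" "t (1 - d) < a + l" "f \<in> F_on 0 1"
    "t \<circ> u \<circ> finv t = rescale a l f"
proof -
  obtain t where t: "t \<in> H" "a < t d" "t (1 - d) < a + l"
    using compress_to_I[of d "1 - d"] d by auto
  have "t \<circ> u \<circ> finv t \<in> F_on (t d) (t (1 - d))"
    using t(1) sub u d by (intro F_on_conj[of t 0 1]) (auto intro: F_on_mono)
  then have "t \<circ> u \<circ> finv t \<in> F_on a (a + l)" by (rule F_on_mono) (use t in auto)
  then show ?thesis using F_on_rescale t that by blast
qed

lemma agree_on_window:
  assumes u: "u \<in> F_on d (1 - d)" and d: "0 < d" "d < 1/2"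
  shows "\<exists>k\<in>H. \<forall>z\<in>{d..1 - d}. k z = u z"
proof -
  obtain t f where t: "t \<in> H" "a < t d" "t (1 - d) < a + l" and f: "f \<in> F_on 0 1"
    "t \<circ> u \<circ> finv t = rescale a l f"
    using F_cpt_conj_I[OF assms] .
  have tF: "t \<in> F_on 0 1" using t sub by blast
  obtain k where k: "k \<in> H" "\<And>z. z \<in> {a..a + l} \<Longrightarrow> k z = rescale a l f z"
    using realise_on_I[OF f(1)] by blast
  have "(finv t \<circ> k \<circ> t) z = u z" if "z \<in> {d..1 - d}" for z
  proof -
    have "t z \<in> {a..a + l}" using that t F_on_le[OF tF, of d z] F_on_le[OF tF, of z "1 - d"] by auto
    then have "k (t z) = (t \<circ> u \<circ> finv t) (t z)" using k(2) f(2) by simp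
    then show ?thesis using tF by simp
  qed
  moreover have "finv t \<circ> k \<circ> t \<in> H" by (intro G(3,4) t(1) k(1))
  ultimately show ?thesis by blast
qed

text \<open>
  Local realisation by elements of \<open>H\<close> that are themselves compactly supported, as the first entry
  in the commutator argument requires.
\<close>

definition realised :: "(real \<Rightarrow> real) set" where
  "realised = {u \<in> F_cpt. \<forall>d. 0 < d \<and> d < 1/2 \<longrightarrow> (\<exists>k\<in>H \<inter> F_cpt. \<forall>z\<in>{d..1 - d}. k z = u z)}"

lemma commutator_in_H: "f \<in> H \<Longrightarrow> g \<in> H \<Longrightarrow> commutator f g \<in> H"
  unfolding commutator_def by (intro G(3,4))

text \<open>
  Elements of \<open>H\<close> that agree on a window with \<open>u\<close> and \<open>v\<close> need not have compact support, but
  their commutator has.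
\<close>

lemma commutator_realised:
  assumes u: "u \<in> F_cpt" and v: "v \<in> F_cpt"
  shows "commutator u v \<in> realised"
  unfolding realised_def
proof (intro CollectI conjI allI impI)
  show "commutator u v \<in> F_cpt" by (rule commutator_F_cpt[OF F_cpt_unit[OF u] F_cpt_unit[OF v]])
  fix e :: real assume "0 < e \<and> e < 1/2"
  then obtain d where d: "0 < d" "d < 1/2" "d \<le> e" and uv: "u \<in> F_on d (1 - d)" "v \<in> F_on d (1 - d)"
    using F_cpt_shrink[OF u v] by blast
  obtain k where k: "k \<in> H" "\<And>z. z \<in> {d..1 - d} \<Longrightarrow> k z = u z" using agree_on_window[OF uv(1) d(1,2)] by blast
  obtain m where m: "m \<in> H" "\<And>z. z \<in> {d..1 - d} \<Longrightarrow> m z = v z" using agree_on_window[OF uv(2) d(1,2)] by blast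
  have F: "k \<in> F_on 0 1" "m \<in> F_on 0 1" using k m sub by auto
  have "commutator k m z = commutator u v z" if z: "z \<in> {d..1 - d}" for z
  proof -
    define w where "w = finv u (finv v z)"
    have w: "w \<in> {d..1 - d}" unfolding w_def
      by (rule F_on_maps(2)[OF F_on_inverse[OF uv(1)] F_on_maps(2)[OF F_on_inverse[OF uv(2)] z]])
    have z_eq: "z = v (u w)" unfolding w_def using uv by simp
    have uw: "u w \<in> {d..1 - d}" "v w \<in> {d..1 - d}" using F_on_maps(2)[OF uv(1) w] F_on_maps(2)[OF uv(2) w] .
    have "z = m (k w)" using z_eq k(2)[OF w] m(2)[OF uw(1)] by simp
    then have "commutator k m z = k (m w)" using commutator_apply[OF F] by simp
    also have "\<dots> = u (v w)" using k(2)[OF uw(2)] m(2)[OF w] by simp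
    also have "\<dots> = commutator u v z" using z_eq commutator_apply[OF uv] by simp
    finally show ?thesis .
  qed
  then show "\<exists>k\<in>H \<inter> F_cpt. \<forall>z\<in>{e..1 - e}. k z = commutator u v z"
    using commutator_in_H[OF k(1) m(1)] commutator_F_cpt[OF F] d(3) by (intro bexI[of _ "commutator k m"]) simp_all
qed

lemma realised_comp:
  assumes u: "u \<in> realised" and v: "v \<in> realised"
  shows "u \<circ> v \<in> realised"
  unfolding realised_def
proof (intro CollectI conjI allI impI)
  have uv: "u \<in> F_cpt" "v \<in> F_cpt" using u v unfolding realised_def by auto
  show "u \<circ> v \<in> F_cpt" by (rule F_cpt_comp[OF uv])
  fix e :: real assume "0 < e \<and> e < 1/2"
  then obtain d where d: "0 < d" "d < 1/2" "d \<le> e" and vd: "v \<in> F_on d (1 - d)"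
    using F_cpt_shrink[OF uv] by blast
  obtain k where k: "k \<in> H" "k \<in> F_cpt" "\<And>z. z \<in> {d..1 - d} \<Longrightarrow> k z = u z"
    using u d unfolding realised_def by blast
  obtain m where m: "m \<in> H" "m \<in> F_cpt" "\<And>z. z \<in> {d..1 - d} \<Longrightarrow> m z = v z"
    using v d unfolding realised_def by blast
  have "(k \<circ> m) z = (u \<circ> v) z" if z: "z \<in> {d..1 - d}" for z
    using k(3)[of "v z"] m(3)[OF z] F_on_maps(2)[OF vd z] by simp
  then show "\<exists>k\<in>H \<inter> F_cpt. \<forall>z\<in>{e..1 - e}. k z = (u \<circ> v) z"
    using G(4)[OF k(1) m(1)] F_cpt_comp[OF k(2) m(2)] d(3) by (intro bexI[of _ "k \<circ> m"]) simp_all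
qed

lemma commutator_realised_in_H:
  assumes u: "u \<in> realised" and v: "v \<in> F_cpt"
  shows "commutator u v \<in> H"
proof -
  have uc: "u \<in> F_cpt" using u unfolding realised_def by simp
  obtain d where d: "0 < d" "d < 1/2" and uv: "u \<in> F_on d (1 - d)" "v \<in> F_on d (1 - d)"
    using F_cpt_shrink[OF uc v zero_less_one] by blast
  obtain k where k: "k \<in> H" "k \<in> F_cpt" "\<And>z. z \<in> {d..1 - d} \<Longrightarrow> k z = u z"
    using u d unfolding realised_def by blast
  obtain c where c: "0 < c" "c < 1/2" "c \<le> d" "k \<in> F_on c (1 - c)"
    using F_cpt_shrink[OF k(2) k(2) d(1)] by blast
  have "v \<in> F_on c (1 - c)" by (rule F_on_mono[OF uv(2)]) (use c in auto)
  from agree_on_window[OF this c(1,2)] obtain m where m: "m \<in> H" "\<And>z. z \<in> {c..1 - c} \<Longrightarrow> m z = v z"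
    by blast
  have "m \<in> F_on 0 1" using m sub by blast
  have "commutator k m = commutator u v"
    by (rule commutator_local[OF uv c(4) _ _ _ k(3) \<open>m \<in> F_on 0 1\<close> m(2)]) (use c d in auto)
  then show ?thesis using commutator_in_H k(1) m(1) by metis
qed

text \<open>
  The expression of \<open>rot\<close> by commutators is used twice: first it shows that the copy of \<open>rot\<close> is locally
  realised with compact support, and then, with this copy as the first entry of both commutators, that
  it belongs to \<open>H\<close>.
\<close>

lemma rescale_rot_in_H:
  assumes p: "p \<in> dyadic_rationals" and m: "m \<in> dyadic_rationals" "0 < m" and b: "0 < p - m" "p + 2 * m < 1"
  shows "rescale p m rot \<in> H"
proof -
  define Z where "Z = rescale 0 2 rot"
  define W where "W = rescale (- 1) 2 rot"
  have F: "Z \<in> F_on (- 1) 2" "W \<in> F_on (- 1) 2" "rot \<in> F_on (- 1) 2"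
    using rescale_in_F_on[OF rot_in_F_on, of 0 2] rescale_in_F_on[OF rot_in_F_on, of "- 1" 2] rot_in_F_on
      dyadic_of_int[of "- 1"]
    unfolding Z_def W_def by (auto intro: F_on_mono)
  define V where "V = finv rot \<circ> finv rot \<circ> W \<circ> rot \<circ> rot"
  have V: "V \<in> F_on (- 1) 2" "finv Z \<in> F_on (- 1) 2" unfolding V_def by (intro F_on_comp F_on_inverse F)+
  have bij: "bij V" "bij (finv Z)" "bij rot" using V F F_on_bij by blast+
  have F_cpt: "rescale p m f \<in> F_cpt" if "f \<in> F_on (- 1) 2" for f
    using rescale_in_F_on[OF that p m] F_on_F_cpt b by (simp add: algebra_simps)
  have eq: "rescale p m rot = commutator (rescale p m rot) (rescale p m (finv Z)) \<circ> commutator (rescale p m rot) (rescale p m V)"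
    using arg_cong[OF rot_commutators, of "rescale p m"] m(2) bij
    unfolding Z_def[symmetric] W_def[symmetric] V_def[symmetric] by (simp only: rescale_comp rescale_commutator)
  have "rescale p m rot \<in> realised"
    by (subst eq) (intro realised_comp commutator_realised F_cpt F V)
  then show ?thesis
    by (subst eq) (intro G(4) commutator_realised_in_H F_cpt V)
qed

theorem F_cpt_subset_H: "F_cpt \<subseteq> H"
proof
  have I: "rescale a l f \<in> H" if f: "f \<in> F_on 0 1" for f
  proof -
    define R where "R = {f \<in> F_on 0 1. rescale a l f \<in> H}"
    have "comp_group R"
      unfolding comp_group_def R_def using G l_pos
      by (auto simp: F_on_bij rescale_inv[symmetric] rescale_comp F_on_inverse F_on_comp)
    moreover have "rescale a l rot \<in> H" "rescale a l (rgt rot) \<in> H"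
    proof -
      show "rescale a l rot \<in> H" using rescale_rot_in_H[OF a l_dyadic(1) l_pos] bounds by simp
      have "a + l * (1/2) \<in> dyadic_rationals" "l * (1/2) \<in> dyadic_rationals"
        by (intro dyadic_add dyadic_mult a l_dyadic dyadic_simps)+
      then have "rescale (a + l * (1/2)) (l * (1/2)) rot \<in> H"
        using l_pos bounds by (intro rescale_rot_in_H) auto
      then show "rescale a l (rgt rot) \<in> H" using l_pos by (simp add: rescale_rescale)
    qed
    ultimately have "f \<in> R" using two_generators[of R f] f rot_in_F_on lft_rgt_unit by (auto simp: R_def)
    then show ?thesis by (simp add: R_def)
  qed
  fix u assume "u \<in> F_cpt"
  then obtain d where d: "0 < d" "d < 1/2" "u \<in> F_on d (1 - d)" unfolding F_cpt_def by blast
  obtain t f where t: "t \<in> H" and f: "f \<in> F_on 0 1" "t \<circ> u \<circ> finv t = rescale a l f"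
    using F_cpt_conj_I[OF d(3,1,2)] by blast
  have tF: "t \<in> F_on 0 1" using t sub by blast
  have "u = finv t \<circ> (t \<circ> u \<circ> finv t) \<circ> t" using tF by (simp add: fun_eq_iff)
  then have "u = finv t \<circ> rescale a l f \<circ> t" using f(2) by simp
  then show "u \<in> H" using G(4)[OF G(4)[OF G(3)[OF t] I[OF f(1)]] t] by simp
qed

end

section \<open>Construction of the second generator\<close>

lemma germ_cong:
  assumes "germ e s f k" "0 < d" "\<And>x. 0 \<le> x \<Longrightarrow> x \<le> d \<Longrightarrow> g (e + s * x) = f (e + s * x)"
  shows "germ e s g k"
proof -
  obtain c where c: "c > 0" "\<And>x. 0 \<le> x \<Longrightarrow> x \<le> c \<Longrightarrow> f (e + s * x) = e + s * (2 powi k * x)"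
    using assms(1) unfolding germ_def by blast
  then show ?thesis unfolding germ_def using assms(2,3) by (intro exI[of _ "min c d"]) auto
qed

lemma germ_funpow: "germ e s f k \<Longrightarrow> germ e s (f ^^ n) (int n * k)"
proof (induction n)
  case 0 then show ?case unfolding germ_def by (intro exI[of _ 1]) auto
next
  case (Suc n)
  then have "germ e s (f \<circ> f ^^ n) (k + int n * k)" by (intro germ_comp)
  moreover have "k + int n * k = int (Suc n) * k" by (simp add: algebra_simps)
  ultimately show ?case by (simp only: funpow.simps)
qed

lemma F_on_funpow: "f \<in> F_on a b \<Longrightarrow> f ^^ n \<in> F_on a b"
  by (induction n) (simp_all only: funpow.simps F_on_comp id_in_F_on)

text \<open>
  Powers of one copy of \<open>rot\<close>, which has slope 2 at its left end and slope 1/2 at its right end.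
\<close>

lemma bump_up:
  assumes p: "p \<in> dyadic_rationals" and l: "l \<in> dyadic_rationals" "0 < l"
  shows "\<exists>h\<in>F_on p (p + l). (\<forall>x. p < x \<and> x < p + l \<longrightarrow> x < h x) \<and>
           germ p 1 h (int (Suc n)) \<and> germ (p + l) (- 1) h (- int (Suc n))"
proof -
  define b where "b = rescale p l rot"
  have F: "b \<in> F_on p (p + l)" using rescale_in_F_on[OF rot_in_F_on p l] by (simp add: b_def)
  have up: "x < b x" if "p < x" "x < p + l" for x
  proof -
    have "0 < (x - p) / l" "(x - p) / l < 1" using that l by (auto simp: field_simps)
    from rot_greater[OF this] show ?thesis using l by (simp add: b_def rescale_def field_simps)
  qed
  have g0: "germ p 1 b 1" unfolding germ_def
    by (rule exI[of _ "l / 4"]) (use l in \<open>auto simp: b_def rescale_def rot_def field_simps\<close>)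
  have g1: "germ (p + l) (- 1) b (- 1)" unfolding germ_def
    by (rule exI[of _ "l / 2"])
       (use l in \<open>auto simp: b_def rescale_def rot_def field_simps power_int_minus\<close>)
  have up': "x < (b ^^ Suc n) x" if "p < x" "x < p + l" for x
  proof (induction n)
    case 0 then show ?case using up that by simp
  next
    case (Suc n)
    have "(b ^^ Suc n) x \<in> {p<..<p + l}"
      by (rule F_on_maps(1)[OF F_on_funpow[OF F]]) (use that in simp)
    then have "(b ^^ Suc n) x < b ((b ^^ Suc n) x)" by (intro up) auto
    then show ?case using Suc by simp
  qed
  show ?thesis
  proof (intro bexI[of _ "b ^^ Suc n"] conjI allI impI)
    show "x < (b ^^ Suc n) x" if "p < x \<and> x < p + l" for x using up' that by blast
    show "germ p 1 (b ^^ Suc n) (int (Suc n))" "germ (p + l) (- 1) (b ^^ Suc n) (- int (Suc n))"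
      using germ_funpow[OF g0, of "Suc n"] germ_funpow[OF g1, of "Suc n"]
      by (simp_all del: funpow.simps)
    show "b ^^ Suc n \<in> F_on p (p + l)" by (rule F_on_funpow[OF F])
  qed
qed

lemma bump:
  assumes p: "p \<in> dyadic_rationals" and q: "q \<in> dyadic_rationals" "p < q" and c: "c \<noteq> 0"
  obtains h where "h \<in> F_on p q" "\<And>x. p < x \<Longrightarrow> x < q \<Longrightarrow> h x \<noteq> x"
    "germ p 1 h c" "germ q (- 1) h (- c)"
proof -
  obtain n where n: "\<bar>c\<bar> = int (Suc n)" by (rule that[of "nat (\<bar>c\<bar> - 1)"]) (use c in simp)
  obtain h where h: "h \<in> F_on p q" "\<And>x. p < x \<Longrightarrow> x < q \<Longrightarrow> x < h x"
    "germ p 1 h \<bar>c\<bar>" "germ q (- 1) h (- \<bar>c\<bar>)"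
    using bump_up[OF p dyadic_diff[OF q(1) p], of n] q(2) unfolding n by auto
  show ?thesis
  proof (cases "0 < c")
    case True
    then show ?thesis using that[of h] h by force
  next
    case False
    have "finv h x \<noteq> x" if "p < x" "x < q" for x
      using h(2)[OF that] h(1) by (metis F_on_inv(1) less_irrefl)
    then show ?thesis using that[OF F_on_inverse[OF h(1)]] germ_inv[OF h(3) F_on_bij[OF h(1)]]
        germ_inv[OF h(4) F_on_bij[OF h(1)]] False by simp
  qed
qed

text \<open>
  The second generator is a product of five pieces with disjoint supports, in order from left to
  right: \<open>h1\<close> on \<open>[0, a]\<close> with the required slope at 0; \<open>h2\<close>, the first generator on \<open>I = [a, b]\<close>;
  \<open>h3\<close>, the conjugate by \<open>f\<close> of the second generator on \<open>I\<close>; \<open>h4\<close>, the conjugate by \<open>f\<^sup>2\<close> of a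
  bump on the larger interval \<open>[a', b]\<close>, so that conjugating back gives an element that fixes \<open>b\<close> and moves
  \<open>a\<close>; and \<open>h5\<close> next to 1 with the required slope there. A point of \<open>(0, 1)\<close> fixed by \<open>f\<close> lies to the left
  of \<open>a'\<close> or to the right of \<open>r = f\<^sup>2 b\<close>, where \<open>h1\<close> or \<open>h5\<close> moves it.
\<close>

lemma partner_up:
  assumes f: "f \<in> F_on 0 1" and x0: "x0 < f x0" and c: "c \<noteq> 0" and d: "d \<noteq> 0"
  shows "\<exists>g\<in>F_on 0 1. germ 0 1 g c \<and> germ 1 (- 1) g d \<and>
           (\<forall>H. comp_group H \<and> H \<subseteq> F_on 0 1 \<and> f \<in> H \<and> g \<in> H \<longrightarrow> F_cpt \<subseteq> H)"
proof -
  have x01: "0 < x0" "x0 < 1" using F_on_fix[OF f, of x0] x0 by force+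
  have fx1: "f x0 < 1" using F_on_maps(1)[OF f, of x0] x01 by simp
  obtain n where n: "(1/2) ^ n < (f x0 - x0) / 4"
    using real_arch_pow_inv[of "(f x0 - x0) / 4" "1/2"] x0 by auto
  define l :: real where "l = 1 / 2 ^ n"
  have l: "0 < l" "4 * l < f x0 - x0" using n by (simp_all add: l_def power_divide)
  \<comment> \<open>The least multiple of l that is at least x0. Four steps of length l fit between x0 and f x0,
    which gives b < f a' and the margins around I.\<close>
  define a' where "a' = of_int \<lceil>x0 * 2 ^ n\<rceil> * l"
  have "x0 * 2 ^ n * l \<le> of_int \<lceil>x0 * 2 ^ n\<rceil> * l" "of_int \<lceil>x0 * 2 ^ n\<rceil> * l < (x0 * 2 ^ n + 1) * l"
    using l(1) by (auto intro!: mult_right_mono mult_strict_right_mono) linarith+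
  then have a': "x0 \<le> a'" "a' < x0 + l" by (auto simp: a'_def l_def field_simps)
  define a where "a = a' + l"
  define b where "b = a + l"
  have b: "b = a' + 2 * l" by (simp add: a_def b_def)
  have fa': "b < f a'"
    using F_on_le[OF f, of x0 a'] a' l by (simp add: b)
  have bounds: "0 < a - l" "a + 2 * l < 1" using a' l x01 fx1 by (auto simp: a_def)
  have lD: "l \<in> dyadic_rationals"
    using dyadic_powi[of "- int n"] by (simp add: l_def power_int_minus inverse_eq_divide)
  have a'D: "a' \<in> dyadic_rationals" unfolding a'_def using lD by (intro dyadic_mult) auto
  have aD: "a \<in> dyadic_rationals" "b \<in> dyadic_rationals" unfolding a_def b_def
    by (intro dyadic_add lD a'D)+
  define r where "r = f (f b)"
  have rD: "r \<in> dyadic_rationals" using aD F_on_dyadic_iff[OF f] by (simp add: r_def)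
  have ord1: "0 < a'" "a' < a" "a < b" "b < 1" using l bounds by (auto simp: a_def b_def)
  then have ord: "0 < a'" "a' < a" "a < b" "b < f a" "f a < f b" "f b < f (f a')"
      "f (f a') < f (f a)" "f (f a) < r"
    unfolding r_def F_on_less[OF f] using fa' less_trans[OF fa', of "f a"] F_on_less[OF f, of a' a]
    by simp_all
  have "b \<in> {0<..<1}" using ord1 by simp
  from F_on_maps(1)[OF f F_on_maps(1)[OF f this]] have r1: "r < 1" by (simp add: r_def)
  obtain h1 where h1: "h1 \<in> F_on 0 a" "\<And>x. 0 < x \<Longrightarrow> x < a \<Longrightarrow> h1 x \<noteq> x" "germ 0 1 h1 c"
    using bump[OF dyadic_simps(1) aD(1) _ c] ord by auto
  obtain h5 where h5: "h5 \<in> F_on r 1" "\<And>x. r < x \<Longrightarrow> x < 1 \<Longrightarrow> h5 x \<noteq> x" "germ 1 (- 1) h5 d"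
    using bump[OF rD dyadic_simps(2) r1, of "- d"] d by auto
  define s where "s = rescale a l (rgt rot)"
  \<comment> \<open>The midpoint of the support is a, and rot moves the midpoint of the unit interval.\<close>
  define t where "t = rescale a' (2 * l) rot"
  have sF: "s \<in> F_on a b" "s \<in> F_on 0 1"
    using rescale_in_F_on[OF lft_rgt_unit(2)[OF rot_in_F_on] aD(1) lD l(1)] ord ord1
    by (auto simp: s_def b_def intro: F_on_mono)
  have tF: "t \<in> F_on a' b" "t \<in> F_on 0 1"
  proof -
    have "2 * l \<in> dyadic_rationals" by (intro dyadic_mult dyadic_simps lD)
    then show "t \<in> F_on a' b" using rescale_in_F_on[OF rot_in_F_on a'D, of "2 * l"] l by (simp add: t_def b)
    then show "t \<in> F_on 0 1" by (rule F_on_mono) (use ord1 in auto)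
  qed
  define h2 where "h2 = rescale a l rot"
  have h2: "h2 \<in> F_on a b"
    using rescale_in_F_on[OF rot_in_F_on aD(1) lD l(1)] by (simp add: h2_def b_def)
  define h3 where "h3 = f \<circ> s \<circ> finv f"
  have h3: "h3 \<in> F_on (f a) (f b)" unfolding h3_def using F_on_conj[OF f sF] .
  have f2: "f \<circ> f \<in> F_on 0 1" by (rule F_on_comp[OF f f])
  define h4 where "h4 = (f \<circ> f) \<circ> t \<circ> finv (f \<circ> f)"
  have h4: "h4 \<in> F_on (f (f a')) r" unfolding h4_def r_def using F_on_conj[OF f2 tF] by simp
  define g where "g = h1 \<circ> h2 \<circ> h3 \<circ> h4 \<circ> h5"
  note fix_off = F_on_fix[OF h1(1)] F_on_fix[OF h2] F_on_fix[OF h3] F_on_fix[OF h4] F_on_fix[OF h5(1)]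
  have g1: "g x = h1 x" if "x \<le> a" for x
    using that ord by (simp add: g_def fix_off)
  have g2: "g x = h2 x" if "a \<le> x" "x \<le> b" for x
    using that ord F_on_maps(2)[OF h2, of x] by (simp add: g_def fix_off)
  have g3: "g x = h3 x" if "f a \<le> x" "x \<le> f b" for x
    using that ord F_on_maps(2)[OF h3, of x] by (simp add: g_def fix_off)
  have g4: "g x = h4 x" if "f (f a') \<le> x" "x \<le> r" for x
    using that ord F_on_maps(2)[OF h4, of x] by (simp add: g_def fix_off)
  have g5: "g x = h5 x" if "r \<le> x" "x \<le> 1" for x
    using that ord F_on_maps(2)[OF h5(1), of x] by (simp add: g_def fix_off)
  have gF: "g \<in> F_on 0 1" unfolding g_def
    by (intro F_on_comp F_on_mono[OF h1(1)] F_on_mono[OF h2] F_on_mono[OF h3] F_on_mono[OF h4]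
        F_on_mono[OF h5(1)]) (use ord r1 in auto)
  have germs: "germ 0 1 g c" "germ 1 (- 1) g d"
  proof -
    show "germ 0 1 g c" by (rule germ_cong[OF h1(3), of a]) (use ord g1 in auto)
    show "germ 1 (- 1) g d" by (rule germ_cong[OF h5(3), of "1 - r"]) (use r1 g5 in auto)
  qed
  have "F_cpt \<subseteq> H" if H: "comp_group H" "H \<subseteq> F_on 0 1" "f \<in> H" "g \<in> H" for H
  proof -
    note G = comp_groupD[OF H(1)]
    have "local_generation H a l n"
    proof
      fix z :: real assume z: "0 < z" "z < 1"
      show "\<exists>h\<in>H. h z \<noteq> z"
      proof (cases "f z = z")
        case True
        have "z < a' \<or> r < z"
        proof (rule ccontr)
          assume "\<not> (z < a' \<or> r < z)"
          then have 1: "a' \<le> z" "z \<le> r" by auto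
          have "f (f z) \<le> f (f b)" using 1(2) unfolding True r_def .
          then have "z \<le> b" unfolding F_on_le[OF f] .
          moreover have "f a' \<le> f z" unfolding F_on_le[OF f] by (rule 1)
          ultimately show False using fa' True by linarith
        qed
        then have "g z \<noteq> z"
        proof
          assume "z < a'"
          then have "z < a" using ord(2) by linarith
          then show ?thesis using g1[of z] h1(2)[of z] z by simp
        next
          assume "r < z"
          then show ?thesis using g5[of z] h5(2)[of z] z by simp
        qed
        then show ?thesis using H(4) by (intro bexI[of _ g])
      next
        case False
        then show ?thesis using H(3) by (intro bexI[of _ f])
      qed
    next
      fix z :: real assume z: "0 < z" "z \<le> a"
      show "\<exists>h\<in>H. h (a + l) = a + l \<and> h z \<noteq> z"
      proof (cases "z = a")
        case False
        then have "g z \<noteq> z" using g1[of z] h1(2)[of z] z by simp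
        moreover have "g b = b" using g2[of b] ord by (simp add: fix_off)
        ultimately show ?thesis using H(4) by (intro bexI[of _ g]) (simp_all flip: b_def)
      next
        case True
        define k where "k = finv (f \<circ> f) \<circ> g \<circ> (f \<circ> f)"
        have "k \<in> H" unfolding k_def by (intro G(3,4) H)
        moreover have k: "k x = t x" if "a' \<le> x" "x \<le> b" for x
        proof -
          have "f (f a') \<le> f (f x)" "f (f x) \<le> r" unfolding r_def F_on_le[OF f] using that .
          then have "g ((f \<circ> f) x) = h4 ((f \<circ> f) x)" using g4[of "(f \<circ> f) x"] by simp
          also have "\<dots> = (f \<circ> f) (t x)" unfolding h4_def using F_on_inv(2)[OF f2, of x] by simp
          finally have "k x = finv (f \<circ> f) ((f \<circ> f) (t x))" by (simp add: k_def)
          then show ?thesis unfolding F_on_inv(2)[OF f2] .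
        qed
        moreover have "k b = b" using k[of b] F_on_fix[OF tF(1), of b] ord(2,3) by simp
        moreover have "k a \<noteq> a" using k[of a] ord(2,3) l by (simp add: t_def rescale_def rot_def a_def)
        ultimately show ?thesis unfolding True b_def[symmetric] by (intro bexI[of _ k] conjI)
      qed
    next
      show "\<exists>k\<in>H. \<forall>z\<in>{a..a + l}. k z = rescale a l rot z"
        using g2 H by (intro bexI[of _ g]) (auto simp: h2_def b_def)
      show "\<exists>k\<in>H. \<forall>z\<in>{a..a + l}. k z = rescale a l (rgt rot) z"
      proof (intro bexI ballI)
        show "finv f \<circ> g \<circ> f \<in> H" by (intro G(3,4) H)
        fix z assume "z \<in> {a..a + l}"
        then show "(finv f \<circ> g \<circ> f) z = rescale a l (rgt rot) z"
          using g3[of "f z"] f by (simp add: h3_def s_def b_def)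
      qed
    qed (use H l_def aD bounds in auto)
    then show ?thesis by (rule local_generation.F_cpt_subset_H)
  qed
  then show ?thesis using gF germs by blast
qed

lemma partner:
  assumes f: "f \<in> F_on 0 1" and "f \<noteq> id" and c: "c \<noteq> 0" and d: "d \<noteq> 0"
  shows "\<exists>g\<in>F_on 0 1. germ 0 1 g c \<and> germ 1 (- 1) g d \<and>
           (\<forall>H. comp_group H \<and> H \<subseteq> F_on 0 1 \<and> f \<in> H \<and> g \<in> H \<longrightarrow> F_cpt \<subseteq> H)"
proof -
  obtain x where "f x \<noteq> x" using assms(2) by (auto simp: fun_eq_iff)
  then consider "x < f x" | "f x < finv f (f x)" using f by fastforce
  then show ?thesis
  proof cases
    case 1 then show ?thesis using partner_up[OF f _ c d] by blast
  next
    case 2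
    from partner_up[OF F_on_inverse[OF f] this c d] obtain g where
      g: "g \<in> F_on 0 1" "germ 0 1 g c \<and> germ 1 (- 1) g d \<and>
        (\<forall>H. comp_group H \<and> H \<subseteq> F_on 0 1 \<and> finv f \<in> H \<and> g \<in> H \<longrightarrow> F_cpt \<subseteq> H)" by (elim bexE)
    show ?thesis
      by (rule bexI[OF _ g(1)]) (use g(2) comp_groupD(3) in simp)
  qed
qed

lemma comp_group_funpow: "comp_group H \<Longrightarrow> f \<in> H \<Longrightarrow> f ^^ n \<in> H"
  by (induction n) (simp_all only: funpow.simps comp_groupD)

text \<open>
  If neither \<open>a\<close>, \<open>c\<close> nor \<open>b\<close>, \<open>d\<close> both vanish, each of \<open>c + n a\<close> and \<open>d + n b\<close> vanishes for at most
  one \<open>n\<close>, so one of \<open>n = 0, 1, 2\<close> makes both nonzero. The partner for these exponents is divided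
  by \<open>f\<^sup>n\<close>.
\<close>

theorem generating_partner:
  assumes f: "f \<in> F_on 0 1" and "f \<noteq> id" and germs: "germ 0 1 f a" "germ 1 (- 1) f b"
    and ac: "a \<noteq> 0 \<or> c \<noteq> 0" and bd: "b \<noteq> 0 \<or> d \<noteq> 0"
  shows "\<exists>g\<in>F_on 0 1. germ 0 1 g c \<and> germ 1 (- 1) g d \<and>
           (\<forall>H. comp_group H \<and> H \<subseteq> F_on 0 1 \<and> f \<in> H \<and> g \<in> H \<longrightarrow> F_cpt \<subseteq> H)"
proof -
  consider "c \<noteq> 0 \<and> d \<noteq> 0" | "c + a \<noteq> 0 \<and> d + b \<noteq> 0" | "c + 2 * a \<noteq> 0 \<and> d + 2 * b \<noteq> 0"
    using ac bd by linarith
  then obtain n :: nat where n: "c + int n * a \<noteq> 0" "d + int n * b \<noteq> 0"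
    by cases (use that[of 0] that[of 1] that[of 2] in auto)
  obtain g where g: "g \<in> F_on 0 1" "germ 0 1 g (c + int n * a)" "germ 1 (- 1) g (d + int n * b)"
    and gH: "\<forall>H. comp_group H \<and> H \<subseteq> F_on 0 1 \<and> f \<in> H \<and> g \<in> H \<longrightarrow> F_cpt \<subseteq> H"
    using partner[OF assms(1,2) n] by (elim bexE conjE)
  define p where "p = f ^^ n"
  have p: "p \<in> F_on 0 1" "germ 0 1 p (int n * a)" "germ 1 (- 1) p (int n * b)"
    unfolding p_def by (rule F_on_funpow[OF f], rule germ_funpow[OF germs(1)], rule germ_funpow[OF germs(2)])
  have "germ 0 1 (finv p \<circ> g) c" "germ 1 (- 1) (finv p \<circ> g) d"
    using germ_comp[OF g(2) germ_inv[OF p(2) F_on_bij[OF p(1)]]]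
      germ_comp[OF g(3) germ_inv[OF p(3) F_on_bij[OF p(1)]]] by simp_all
  moreover have "F_cpt \<subseteq> H" if "comp_group H" "H \<subseteq> F_on 0 1" "f \<in> H" "finv p \<circ> g \<in> H" for H
  proof -
    have "p \<circ> (finv p \<circ> g) \<in> H"
      by (rule comp_groupD(4)[OF that(1) _ that(4)]) (simp add: p_def comp_group_funpow that)
    moreover have "p \<circ> (finv p \<circ> g) = g" using p(1) by (simp add: fun_eq_iff)
    ultimately show ?thesis using gH that(1-3) by simp
  qed
  ultimately show ?thesis
    by (intro bexI[OF _ F_on_comp[OF g(1) F_on_inverse[OF p(1)]]] conjI allI impI) auto
qed

section \<open>Transfer to the extensional model\<close>

text \<open>
  The isomorphism from the functions on the line onto the carrier of the group.
\<close>

definition restr :: "(real \<Rightarrow> real) \<Rightarrow> real \<Rightarrow> real" where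
  "restr f = restrict f {0..1}"

lemma F_on_continuous: assumes f: "f \<in> F_on a b" shows "continuous_on S f"
proof -
  have "surj f" using F_on_bij[OF f] by (rule bij_is_surj)
  then have "continuous_on UNIV f" using f by (intro continuous_onI_mono) auto
  then show ?thesis by (rule continuous_on_subset) simp
qed

lemma restr_Bij: assumes f: "f \<in> F_on 0 1" shows "restr f \<in> Bij {0..1}"
proof -
  have "bij_betw f {0..1} {0..1}"
    by (rule bij_betw_byWitness[of _ "finv f"])
       (use f F_on_maps(2)[OF f] F_on_maps(2)[OF F_on_inverse[OF f]] in auto)
  then show ?thesis by (simp add: Bij_def restr_def)
qed

lemma restr_in_carrier: assumes f: "f \<in> F_on 0 1" shows "restr f \<in> carrier thompson_F"
proof -
  obtain B where B: "finite B" "B \<subseteq> dyadic_rationals" "breaks_in B f"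
    using F_onE[OF f] .
  have "homeomorphism {0..1} {0..1} (restr f) (restr (finv f))"
  proof (rule homeomorphismI)
    show "continuous_on {0..1} (restr f)" "continuous_on {0..1} (restr (finv f))"
      by (rule continuous_on_eq[OF F_on_continuous[OF f]], simp add: restr_def)
        (rule continuous_on_eq[OF F_on_continuous[OF F_on_inverse[OF f]]], simp add: restr_def)
  qed (use f F_on_maps(2)[OF f] F_on_maps(2)[OF F_on_inverse[OF f]] in \<open>auto simp: restr_def\<close>)
  moreover have "dyadic_piecewise_linear (restr f)"
    unfolding dyadic_piecewise_linear_def
  proof (intro exI[of _ "B \<inter> {0<..<1}"] conjI allI impI)
    fix u v :: real assume uv: "0 \<le> u \<and> u < v \<and> v \<le> 1 \<and> {u<..<v} \<inter> (B \<inter> {0<..<1}) = {}"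
    then have "{u<..<v} \<subseteq> {0<..<1}" by auto
    then have "u < v" "{u<..<v} \<inter> B = {}" using uv by blast+
    then obtain k c where "\<forall>x\<in>{u..v}. f x = 2 powi k * x + c"
      using B(3) unfolding breaks_in_def by meson
    then show "\<exists>(k::int) c. \<forall>x\<in>{u..v}. restr f x = 2 powi k * x + c"
      using uv by (intro exI[of _ k] exI[of _ c]) (auto simp: restr_def)
  qed (use B in auto)
  ultimately show ?thesis using restr_Bij[OF f] by (auto simp: thompson_F_def)
qed

text \<open>
  To see that \<open>\<phi>\<close> is increasing and fixes 0 and 1, it is first extended to the line by translations,
  which is continuous whatever the values at 0 and 1 are; then the monotonicity of functions
  with finitely many breaks applies, and surjectivity gives the end points.
\<close>

lemma carrier_restr:
  assumes \<phi>: "\<phi> \<in> carrier thompson_F"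
  obtains f where "f \<in> F_on 0 1" "\<phi> = restr f"
proof -
  have Bij: "\<phi> \<in> extensional {0..1}" "inj_on \<phi> {0..1}" "\<phi> ` {0..1} = {0..1}"
    and pl: "dyadic_piecewise_linear \<phi>"
    using \<phi> by (auto simp: thompson_F_def Bij_def bij_betw_def)
  obtain B where B: "finite B" "B \<subseteq> dyadic_rationals \<inter> {0<..<1}"
    and aff: "\<forall>u v. 0 \<le> u \<and> u < v \<and> v \<le> 1 \<and> {u<..<v} \<inter> B = {} \<longrightarrow>
         (\<exists>(k::int) c. \<forall>x\<in>{u..v}. \<phi> x = 2 powi k * x + c)"
    using pl unfolding dyadic_piecewise_linear_def by (elim exE conjE)
  define f where "f x = (if x < 0 then x + \<phi> 0 else if x \<le> 1 then \<phi> x else x - 1 + \<phi> 1)" for x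
  have br: "breaks_in (B \<union> {0, 1}) f"
  proof (rule breaks_inI)
    fix u v :: real assume uv: "u < v" "{u<..<v} \<inter> (B \<union> {0, 1}) = {}"
    then have e: "{u<..<v} \<inter> B = {}" and "v \<le> 0 \<or> 0 \<le> u" "v \<le> 1 \<or> 1 \<le> u" by auto
    then consider "v \<le> 0" | "0 \<le> u" "v \<le> 1" | "1 \<le> u" by blast
    then show "\<exists>(k::int) c. \<forall>x\<in>{u..v}. f x = 2 powi k * x + c"
    proof cases
      case 1
      have "f x = x + \<phi> 0" if "x \<le> 0" for x using that by (cases "x = 0") (auto simp: f_def)
      then show ?thesis using 1 by (intro exI[of _ "0 :: int"] exI[of _ "\<phi> 0"]) auto
    next
      case 2
      then obtain k c where "\<forall>x\<in>{u..v}. \<phi> x = 2 powi k * x + c" using aff uv(1) e by meson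
      then show ?thesis using 2 by (intro exI[of _ k] exI[of _ c]) (auto simp: f_def)
    next
      case 3
      have "f x = x + (\<phi> 1 - 1)" if "1 \<le> x" for x using that by (cases "x = 1") (auto simp: f_def)
      then show ?thesis using 3 by (intro exI[of _ "0 :: int"] exI[of _ "\<phi> 1 - 1"]) auto
    qed
  qed
  have mono: "strict_mono f" by (rule breaks_in_strict_mono[OF br]) (use B in simp)
  have range: "\<phi> x \<in> {0..1}" if "x \<in> {0..1}" for x using Bij(3) that by blast
  have mono': "\<phi> x \<le> \<phi> y" if "0 \<le> x" "x \<le> y" "y \<le> 1" for x y
    using strict_mono_mono[OF mono] that monoD[of f x y] by (simp add: f_def)
  obtain x where x: "x \<in> {0..1}" "\<phi> x = 0" using Bij(3) by (metis atLeastAtMost_iff imageE order_refl zero_le_one)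
  have 0: "\<phi> 0 = 0" using mono'[of 0 x] x range[of 0] by auto
  obtain x where x: "x \<in> {0..1}" "\<phi> x = 1" using Bij(3) by (metis atLeastAtMost_iff imageE order_refl zero_le_one)
  have 1: "\<phi> 1 = 1" using mono'[of x 1] x range[of 1] by auto
  have f: "f x = (if x \<in> {0..1} then \<phi> x else x)" for x unfolding f_def using 0 1 by auto
  have "surj f"
  proof (rule surjI[of f "\<lambda>y. if y \<in> {0..1} then inv_into {0..1} \<phi> y else y"])
    fix y show "f (if y \<in> {0..1} then inv_into {0..1} \<phi> y else y) = y"
      using inv_into_into[of y \<phi> "{0..1}"] f_inv_into_f[of y \<phi> "{0..1}"] Bij(3)
      by (auto simp: f)
  qed
  then have "bij f" using mono by (auto simp: bij_def strict_mono_imp_inj_on)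
  moreover have "\<forall>x. x \<notin> {0<..<1} \<longrightarrow> f x = x" using f 0 1 by (auto simp: le_less)
  moreover have "finite (B \<union> {0, 1})" "B \<union> {0, 1} \<subseteq> dyadic_rationals" using B by auto
  ultimately have "f \<in> F_on 0 1" unfolding F_on_def using br by blast
  moreover have "\<phi> = restr f" using Bij(1) f by (auto simp: restr_def fun_eq_iff extensional_def)
  ultimately show ?thesis using that by blast
qed

lemma restr_mult:
  assumes "f \<in> F_on 0 1" "g \<in> F_on 0 1"
  shows "restr f \<otimes>\<^bsub>thompson_F\<^esub> restr g = restr (f \<circ> g)"
  using restr_Bij[OF assms(1)] restr_Bij[OF assms(2)] F_on_maps(2)[OF assms(2)]
  by (auto simp: thompson_F_def BijGroup_def compose_def restr_def fun_eq_iff)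

lemma restr_one: "\<one>\<^bsub>thompson_F\<^esub> = restr id"
  by (auto simp: thompson_F_def BijGroup_def restr_def fun_eq_iff)

lemma group_thompson_F: "group thompson_F"
proof (rule groupI)
  fix x y assume "x \<in> carrier thompson_F" "y \<in> carrier thompson_F"
  then obtain f g where f: "f \<in> F_on 0 1" "x = restr f" and g: "g \<in> F_on 0 1" "y = restr g"
    using carrier_restr by metis
  show "x \<otimes>\<^bsub>thompson_F\<^esub> y \<in> carrier thompson_F"
    using restr_in_carrier[OF F_on_comp[OF g(1) f(1)]] restr_mult[OF f(1) g(1)] f g by simp
  fix z assume "z \<in> carrier thompson_F"
  then obtain h where h: "h \<in> F_on 0 1" "z = restr h" using carrier_restr by metis
  show "x \<otimes>\<^bsub>thompson_F\<^esub> y \<otimes>\<^bsub>thompson_F\<^esub> z = x \<otimes>\<^bsub>thompson_F\<^esub> (y \<otimes>\<^bsub>thompson_F\<^esub> z)"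
    unfolding f g h restr_mult[OF f(1) g(1)] restr_mult[OF g(1) h(1)]
      restr_mult[OF F_on_comp[OF g(1) f(1)] h(1)] restr_mult[OF f(1) F_on_comp[OF h(1) g(1)]] comp_assoc ..
next
  fix x assume "x \<in> carrier thompson_F"
  then obtain f where f: "f \<in> F_on 0 1" "x = restr f" using carrier_restr by metis
  show "\<one>\<^bsub>thompson_F\<^esub> \<otimes>\<^bsub>thompson_F\<^esub> x = x"
    unfolding restr_one f restr_mult[OF id_in_F_on f(1)] by simp
  show "\<exists>y\<in>carrier thompson_F. y \<otimes>\<^bsub>thompson_F\<^esub> x = \<one>\<^bsub>thompson_F\<^esub>"
    by (rule bexI[OF _ restr_in_carrier[OF F_on_inverse[OF f(1)]]])
       (simp only: restr_one f(2) restr_mult[OF F_on_inverse[OF f(1)] f(1)] F_on_inv(4)[OF f(1)])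
qed (use restr_in_carrier id_in_F_on restr_one in metis)

lemma restr_inv:
  assumes f: "f \<in> F_on 0 1"
  shows "inv\<^bsub>thompson_F\<^esub> restr f = restr (finv f)"
  by (rule group.inv_equality[OF group_thompson_F _ restr_in_carrier[OF f] restr_in_carrier[OF F_on_inverse[OF f]]])
     (simp only: restr_one restr_mult[OF F_on_inverse[OF f] f] F_on_inv(4)[OF f])

lemma pi_ab_restr:
  assumes g: "germ 0 1 f k" "germ 1 (- 1) f m"
  shows "pi_ab (restr f) = (k, m)"
proof -
  obtain c where c: "c > 0" "\<And>x. 0 \<le> x \<Longrightarrow> x \<le> c \<Longrightarrow> f x = 2 powi k * x"
    using g(1) unfolding germ_def by auto
  have "((\<lambda>x. 2 powi k * x) has_vector_derivative 2 powi k) (at 0 within {0..})"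
    by (auto intro!: derivative_eq_intros simp: has_real_derivative_iff_has_vector_derivative[symmetric])
  then have "(restr f has_vector_derivative 2 powi k) (at 0 within {0..})"
    by (rule has_vector_derivative_transform_within[of _ _ _ _ "min c 1"])
       (use c in \<open>auto simp: restr_def dist_real_def\<close>)
  then have "(restr f has_vector_derivative 2 powi k) (at_right 0)"
    by (rule has_vector_derivative_within_subset) auto
  then have 1: "vector_derivative (restr f) (at_right 0) = 2 powi k"
    by (intro vector_derivative_within) auto
  obtain d where d: "d > 0" "\<And>x. 0 \<le> x \<Longrightarrow> x \<le> d \<Longrightarrow> f (1 - x) = 1 - 2 powi m * x"
    using g(2) unfolding germ_def by auto
  have "((\<lambda>x. 1 - 2 powi m * (1 - x)) has_vector_derivative 2 powi m) (at 1 within {..1})"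
    by (auto intro!: derivative_eq_intros simp: has_real_derivative_iff_has_vector_derivative[symmetric])
  then have "(restr f has_vector_derivative 2 powi m) (at 1 within {..1})"
  proof (rule has_vector_derivative_transform_within[of _ _ _ _ "min d 1"])
    fix x :: real assume "x \<in> {..1}" "dist x 1 < min d 1"
    then show "1 - 2 powi m * (1 - x) = restr f x"
      using d(2)[of "1 - x"] by (auto simp: restr_def dist_real_def)
  qed (use d in auto)
  then have "(restr f has_vector_derivative 2 powi m) (at_left 1)"
    by (rule has_vector_derivative_within_subset) auto
  then have 2: "vector_derivative (restr f) (at_left 1) = 2 powi m"
    by (intro vector_derivative_within) auto
  have "log 2 (2 powi i) = of_int i" for i
    by (simp add: powr_real_of_int'[symmetric])
  then show ?thesis unfolding pi_ab_def 1 2 by simp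
qed

lemma group_Z2: "group Z2"
  by (intro DirProd_group group_integer_group)

lemma pi_ab_hom: "pi_ab \<in> hom thompson_F Z2"
proof (rule homI)
  fix x y assume "x \<in> carrier thompson_F" "y \<in> carrier thompson_F"
  then obtain f g where f: "f \<in> F_on 0 1" "x = restr f" and g: "g \<in> F_on 0 1" "y = restr g"
    using carrier_restr by metis
  obtain k m where k: "germ 0 1 f k" "germ 1 (- 1) f m" using germ_ends[OF f(1)] by blast
  obtain k' m' where k': "germ 0 1 g k'" "germ 1 (- 1) g m'" using germ_ends[OF g(1)] by blast
  show "pi_ab (x \<otimes>\<^bsub>thompson_F\<^esub> y) = pi_ab x \<otimes>\<^bsub>Z2\<^esub> pi_ab y"
    unfolding f g restr_mult[OF f(1) g(1)] pi_ab_restr[OF k] pi_ab_restr[OF k']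
      pi_ab_restr[OF germ_comp[OF k'(1) k(1)] germ_comp[OF k'(2) k(2)]] by simp
qed simp

lemma kernel_pi_ab_F_cpt:
  assumes f: "f \<in> F_on 0 1" and "pi_ab (restr f) = (0, 0)"
  shows "f \<in> F_cpt"
proof -
  obtain k m where k: "germ 0 1 f k" "germ 1 (- 1) f m" using germ_ends[OF f] by blast
  then have "k = 0" "m = 0" using pi_ab_restr[OF k] assms(2) by auto
  then show ?thesis using germ_zero_F_cpt f k by blast
qed

theorem theorem2:
  fixes a b c d :: int and f :: "real \<Rightarrow> real"
  assumes "{a, c} \<noteq> {0}" and "{b, d} \<noteq> {0}"
    and "f \<in> carrier thompson_F" and "f \<noteq> \<one>\<^bsub>thompson_F\<^esub>"
    and "pi_ab f = (a, b)"
  shows "\<exists>g \<in> carrier thompson_F. pi_ab g = (c, d) \<and>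
           generate thompson_F {f, g} =
             {h \<in> carrier thompson_F. pi_ab h \<in> generate Z2 {(a, b), (c, d)}}"
proof -
  interpret F: group thompson_F by (rule group_thompson_F)
  interpret pi: group_hom thompson_F Z2 pi_ab
    by (intro group_hom.intro group_hom_axioms.intro group_thompson_F group_Z2 pi_ab_hom)
  obtain f0 where f0: "f0 \<in> F_on 0 1" "f = restr f0" using carrier_restr assms(3) by metis
  obtain k m where k: "germ 0 1 f0 k" "germ 1 (- 1) f0 m" using germ_ends[OF f0(1)] by blast
  have "k = a" "m = b" using pi_ab_restr[OF k] assms(5) f0(2) by auto
  moreover have "f0 \<noteq> id" using assms(4) f0(2) restr_one by auto
  ultimately obtain g0 where g0: "g0 \<in> F_on 0 1" "germ 0 1 g0 c" "germ 1 (- 1) g0 d"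
    and contains: "\<forall>H. comp_group H \<and> H \<subseteq> F_on 0 1 \<and> f0 \<in> H \<and> g0 \<in> H \<longrightarrow> F_cpt \<subseteq> H"
    using generating_partner[OF f0(1) _ k, of c d] assms(1,2) by auto
  define g where "g = restr g0"
  have g: "g \<in> carrier thompson_F" "pi_ab g = (c, d)"
    unfolding g_def using restr_in_carrier[OF g0(1)] pi_ab_restr[OF g0(2,3)] by auto
  have fg: "{f, g} \<subseteq> carrier thompson_F" using assms(3) g by simp
  note sg = F.generate_is_subgroup[OF fg]
  define H where "H = {h \<in> F_on 0 1. restr h \<in> generate thompson_F {f, g}}"
  have "comp_group H"
    unfolding comp_group_def
  proof (intro conjI ballI)
    show "id \<in> H" using generate.one[of thompson_F "{f, g}"] by (simp add: H_def restr_one)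
  next
    fix h assume "h \<in> H"
    then have h: "h \<in> F_on 0 1" "restr h \<in> generate thompson_F {f, g}" by (auto simp: H_def)
    show "bij h" using F_on_bij[OF h(1)] .
    show "finv h \<in> H"
      using subgroup.m_inv_closed[OF sg h(2)] F_on_inverse[OF h(1)] by (simp add: H_def restr_inv h(1))
    fix h' assume "h' \<in> H"
    then have h': "h' \<in> F_on 0 1" "restr h' \<in> generate thompson_F {f, g}" by (auto simp: H_def)
    show "h \<circ> h' \<in> H"
      unfolding H_def using subgroup.m_closed[OF sg h(2) h'(2)] F_on_comp[OF h'(1) h(1)]
      by (simp only: restr_mult[OF h(1) h'(1)] mem_Collect_eq simp_thms)
  qed
  moreover have "f0 \<in> H" "g0 \<in> H"
    unfolding H_def using f0 g0(1) generate.incl[of _ "{f, g}" thompson_F] by (auto simp: g_def)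
  ultimately have F_cpt: "F_cpt \<subseteq> H" using contains by (auto simp: H_def)
  have img: "pi_ab ` generate thompson_F {f, g} = generate Z2 {(a, b), (c, d)}"
    using pi.generate_img[OF fg] assms(5) g(2) by simp
  have "h \<in> generate thompson_F {f, g}"
    if h: "h \<in> carrier thompson_F" "pi_ab h \<in> generate Z2 {(a, b), (c, d)}" for h
  proof -
    obtain w where w: "w \<in> generate thompson_F {f, g}" "pi_ab w = pi_ab h" using img h(2) by force
    have wc: "w \<in> carrier thompson_F" using w(1) F.generate_in_carrier[OF fg] by blast
    define u where "u = h \<otimes>\<^bsub>thompson_F\<^esub> inv\<^bsub>thompson_F\<^esub> w"
    have uc: "u \<in> carrier thompson_F" unfolding u_def using h(1) wc by simp
    have "pi_ab u = \<one>\<^bsub>Z2\<^esub>"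
      unfolding u_def using h(1) wc w(2) group.r_inv[OF group_Z2, of "pi_ab h"] by simp
    then have "pi_ab u = (0, 0)" by simp
    moreover obtain u0 where u0: "u0 \<in> F_on 0 1" "u = restr u0" using carrier_restr uc by metis
    ultimately have "u0 \<in> H" using kernel_pi_ab_F_cpt F_cpt by blast
    then have "u \<otimes>\<^bsub>thompson_F\<^esub> w \<in> generate thompson_F {f, g}"
      using w(1) generate.eng u0(2) by (auto simp: H_def)
    moreover have "u \<otimes>\<^bsub>thompson_F\<^esub> w = h" unfolding u_def using h(1) wc by (simp add: F.m_assoc)
    ultimately show ?thesis by simp
  qed
  then have "generate thompson_F {f, g} =
      {h \<in> carrier thompson_F. pi_ab h \<in> generate Z2 {(a, b), (c, d)}}"
    using img F.generate_in_carrier[OF fg] by blast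
  then show ?thesis using g by blast
qed

end
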